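(* Let $d\ge1$, $\alpha>0$, $\delta>0$ and $C_0,C_1,C_2<\infty$. Let $\psi_i:\mathbb{R}\to\mathbb{R}$ ($i\in\mathbb{Z}^d$) be smooth functions admitting splittings $\psi_i=\psi_i^c+\psi_i^b$ with $$(\psi_i^c)''(z)\ge 0,\qquad |\psi_i^b(z)|+|(\psi_i^b)'(z)|\le C_0\qquad\text{for all } i\in\mathbb{Z}^d,\ z\in\mathbb{R},$$ and let $M=(M_{ij})_{i,j\in\mathbb{Z}^d}$ be a real matrix with $M_{ij}=M_{ji}$ for all $i,j$ and $\sum_{j\ne i}|M_{ij}|+\delta\le M_{ii}$ for all $i\in\mathbb{Z}^d$. Assume that $$|M_{ij}|\le\frac{C_1}{|i-j|^{d+\alpha}}\qquad\text{for all } i\ne j\text{ in }\mathbb{Z}^d,$$ and that $$|\operatorname{cov}_{\mu_\Lambda}(x_i,x_j)|\le\frac{C_2}{|i-j|^{d+\alpha}}$$ for all finite $\Lambda\subset\mathbb{Z}^d$, all $i\neq j$ in $\Lambda$, and all finite-volume Gibbs measures $\mu_\Lambda$ (i.e. uniformly in the tempered boundary values $x^{\mathbb{Z}^d\setminus\Lambda}$). Then there is at most one infinite-volume Gibbs measure $\mu$ associated to the Hamiltonian $H$ satisfying $$\sup_{i\in\mathbb{Z}^d}\int x_i^2\,\mu(dx)<\infty.$$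
   Context: The formal Hamiltonian is $H(x)=\sum_{i\in\mathbb{Z}^d}\psi_i(x_i)+\frac12\sum_{i,j\in\mathbb{Z}^d}M_{ij}x_ix_j$ for $x\in\mathbb{R}^{\mathbb{Z}^d}$. For $S\subset\mathbb{Z}^d$ write $x^S=(x_i)_{i\in S}$. Tempered: for a finite $\Lambda\subset\mathbb{Z}^d$, the values $x^{\mathbb{Z}^d\setminus\Lambda}$ are tempered if $\sum_{j\in\mathbb{Z}^d\setminus\Lambda}|M_{ij}||x_j|<\infty$ for all $i\in\Lambda$. Finite-volume Gibbs measure: for finite $\Lambda$ and tempered boundary values $x^{\mathbb{Z}^d\setminus\Lambda}$, $\mu_\Lambda$ is the probability measure on $\mathbb{R}^\Lambda$ with density $\mu_\Lambda(dx^\Lambda)=\frac1Z e^{-H(x^\Lambda,x^{\mathbb{Z}^d\setminus\Lambda})}dx^\Lambda$, where only the terms of $H$ depending on $x^\Lambda$ matter, i.e. $H$ may be replaced by $\sum_{i\in\Lambda}\psi_i(x_i)+\frac12\sum_{i,j\in\Lambda}M_{ij}x_ix_j+\sum_{i\in\Lambda,\,j\notin\Lambda}M_{ij}x_ix_j$. The measure $\mu_\Lambda$ depends on the boundary values. Infinite-volume Gibbs measure: a probability measure $\mu$ on $\mathbb{R}^{\mathbb{Z}^d}$ with the product Borel sigma-algebra is an infinite-volume Gibbs measure associated to $H$ if for every finite $\Lambda\subset\mathbb{Z}^d$, decomposing $\mu$ into the conditional measure $\mu(dx^\Lambda|x^{\mathbb{Z}^d\setminus\Lambda})$ and the marginal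 $\bar\mu(dx^{\mathbb{Z}^d\setminus\Lambda})$, so that $\int f\,d\mu=\int\int f(x)\,\mu(dx^\Lambda|x^{\mathbb{Z}^d\setminus\Lambda})\,\bar\mu(dx^{\mathbb{Z}^d\setminus\Lambda})$ for test functions $f$, the conditional measures are given by the finite-volume Gibbs measures: $\mu(dx^\Lambda|x^{\mathbb{Z}^d\setminus\Lambda})=\mu_\Lambda(dx^\Lambda)$ (for $\bar\mu$-almost every, tempered, $x^{\mathbb{Z}^d\setminus\Lambda}$). $\operatorname{cov}_\mu(f,g)=\int fg\,d\mu-\int f\,d\mu\int g\,d\mu$, and $|i-j|$ is the Euclidean distance on $\mathbb{Z}^d$. *)

theory Defs
  imports "HOL-Probability.Probability"
begin

text \<open>
  The lattice $\mathbb{Z}^d$ is the type \<open>int ^ 'd\<close> with $d$ = \<open>CARD('d)\<close>, and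
  a configuration is a function on it. Boundary values on the complement of a finite set
  \<open>\<Lambda>\<close> are also passed as functions on the whole lattice; their values on \<open>\<Lambda>\<close> are never used.
\<close>

type_synonym 'd config = "int ^ 'd \<Rightarrow> real"

definition lattice_dist :: "int ^ 'd \<Rightarrow> int ^ 'd \<Rightarrow> real" where
  "lattice_dist i j = norm (\<chi> k. real_of_int (i $ k - j $ k))"

definition smooth :: "(real \<Rightarrow> real) \<Rightarrow> bool" where
  "smooth f \<longleftrightarrow> (\<forall>n z. (deriv ^^ n) f differentiable (at z))"

definition tempered ::
    "(int ^ 'd \<Rightarrow> int ^ 'd \<Rightarrow> real) \<Rightarrow> (int ^ 'd) set \<Rightarrow> 'd config \<Rightarrow> bool" where
  "tempered M \<Lambda> \<omega> \<longleftrightarrow> (\<forall>i\<in>\<Lambda>. (\<lambda>j. \<bar>M i j\<bar> * \<bar>\<omega> j\<bar>) summable_on (- \<Lambda>))"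

definition hamiltonian ::
    "(int ^ 'd \<Rightarrow> real \<Rightarrow> real) \<Rightarrow> (int ^ 'd \<Rightarrow> int ^ 'd \<Rightarrow> real) \<Rightarrow>
     (int ^ 'd) set \<Rightarrow> 'd config \<Rightarrow> 'd config \<Rightarrow> real" where
  "hamiltonian \<psi> M \<Lambda> \<omega> x =
     (\<Sum>i\<in>\<Lambda>. \<psi> i (x i)) + 1/2 * (\<Sum>i\<in>\<Lambda>. \<Sum>j\<in>\<Lambda>. M i j * x i * x j)
     + (\<Sum>i\<in>\<Lambda>. \<Sum>\<^sub>\<infinity>j\<in>- \<Lambda>. M i j * x i * \<omega> j)"

definition finite_volume_gibbs ::
    "(int ^ 'd \<Rightarrow> real \<Rightarrow> real) \<Rightarrow> (int ^ 'd \<Rightarrow> int ^ 'd \<Rightarrow> real) \<Rightarrow>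
     (int ^ 'd) set \<Rightarrow> 'd config \<Rightarrow> 'd config measure" where
  "finite_volume_gibbs \<psi> M \<Lambda> \<omega> =
     (let L = PiM \<Lambda> (\<lambda>_. lborel);
          Z = (LINT x|L. exp (- hamiltonian \<psi> M \<Lambda> \<omega> x))
      in density L (\<lambda>x. ennreal (exp (- hamiltonian \<psi> M \<Lambda> \<omega> x) / Z)))"

text \<open>
  The marginal of \<open>\<mu>\<close> on the coordinates outside \<open>\<Lambda>\<close>, and the disintegration of \<open>\<mu>\<close> into
  that marginal and a (measurable) family \<open>\<kappa>\<close> of conditional probability measures on the
  coordinates in \<open>\<Lambda>\<close>. The test functions are the nonnegative measurable ones.
\<close>

definition outer_marginal :: "'d config measure \<Rightarrow> (int ^ 'd) set \<Rightarrow> 'd config measure" where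
  "outer_marginal \<mu> \<Lambda> = distr \<mu> (PiM (- \<Lambda>) (\<lambda>_. borel)) (\<lambda>x. restrict x (- \<Lambda>))"

definition conditional_measure ::
    "'d config measure \<Rightarrow> (int ^ 'd) set \<Rightarrow> ('d config \<Rightarrow> 'd config measure) \<Rightarrow> bool" where
  "conditional_measure \<mu> \<Lambda> \<kappa> \<longleftrightarrow>
     \<kappa> \<in> PiM (- \<Lambda>) (\<lambda>_. borel) \<rightarrow>\<^sub>M prob_algebra (PiM \<Lambda> (\<lambda>_. borel)) \<and>
     (\<forall>f :: 'd config \<Rightarrow> ennreal. f \<in> borel_measurable (PiM UNIV (\<lambda>_. borel)) \<longrightarrow>
        (\<integral>\<^sup>+ x. f x \<partial>\<mu>) =
        (\<integral>\<^sup>+ y. (\<integral>\<^sup>+ x. f (merge \<Lambda> (- \<Lambda>) (x, y)) \<partial>\<kappa> y) \<partial>outer_marginal \<mu> \<Lambda>))"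

definition infinite_volume_gibbs ::
    "(int ^ 'd \<Rightarrow> real \<Rightarrow> real) \<Rightarrow> (int ^ 'd \<Rightarrow> int ^ 'd \<Rightarrow> real) \<Rightarrow> 'd config measure \<Rightarrow> bool" where
  "infinite_volume_gibbs \<psi> M \<mu> \<longleftrightarrow>
     prob_space \<mu> \<and> sets \<mu> = sets (PiM UNIV (\<lambda>_. borel)) \<and>
     (\<forall>\<Lambda>. finite \<Lambda> \<longrightarrow>
        (\<exists>\<kappa>. conditional_measure \<mu> \<Lambda> \<kappa> \<and>
             (AE y in outer_marginal \<mu> \<Lambda>.
                tempered M \<Lambda> y \<and> \<kappa> y = finite_volume_gibbs \<psi> M \<Lambda> y)))"

definition cov :: "'a measure \<Rightarrow> ('a \<Rightarrow> real) \<Rightarrow> ('a \<Rightarrow> real) \<Rightarrow> real" where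
  "cov \<mu> f g = (LINT x|\<mu>. f x * g x) - (LINT x|\<mu>. f x) * (LINT x|\<mu>. g x)"

end

theory Submission
  imports Defs
begin

text \<open>
Let \<open>\<mu>\<close> be an infinite-volume Gibbs measure with bounded second moments and let \<open>f\<close> be the indicator of a
cylinder over a finite set \<open>A\<close> of sites. The \<open>\<mu>\<close>-expectation of \<open>f\<close> is an average, over \<open>\<mu>\<close>-random boundary values \<open>\<omega>\<close>, of
its expectation under the finite-volume measure in a finite volume \<open>\<Lambda> \<supseteq> A\<close>. If the latter depends so little on
\<open>\<omega>\<close> that the averaged error vanishes as \<open>\<Lambda>\<close> grows, then the \<open>\<mu>\<close>-probability of every cylinder is a limit of
finite-volume probabilities with zero boundary values. This limit does not involve \<open>\<mu>\<close>, so any two such measures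
agree (\<open>at_most_one_gibbs_measure\<close>).

To see the dependence on the boundary, scale the boundary values from \<open>0\<close> to \<open>\<omega>\<close>. They enter the energy linearly,
through the field \<open>\<Sum>j\<notin>\<Lambda>. M i j * \<omega> j\<close> at \<open>i\<close>, so the derivative of the expectation is a covariance
(\<open>gibbs_field_comparison\<close>) and the change is at most
\<open>\<Sum>i\<in>\<Lambda>. c i * (\<Sum>j\<notin>\<Lambda>. \<bar>M i j\<bar> * \<bar>\<omega> j\<bar>)\<close>, where \<open>c i\<close> bounds the covariance of \<open>f\<close> and \<open>x i\<close>. After averaging, the
factors \<open>\<bar>\<omega> j\<bar>\<close> are replaced by a constant. If \<open>c\<close> is summable over the whole lattice, the double sum tends to zero:
for fixed \<open>i\<close> the inner sum is the tail of a convergent series, and its values are uniformly bounded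
(\<open>boundary_weight_small\<close>).

What remains is a summable bound \<open>c i\<close> for the covariance of \<open>f\<close> and \<open>x i\<close>, uniform in \<open>\<Lambda>\<close> and \<open>\<omega>\<close>, whereas the hypothesis only speaks
of covariances of two distinct coordinates. Condition on the coordinates in \<open>A\<close>: the covariance of \<open>f\<close> and \<open>x i\<close> is the covariance of \<open>f\<close> and the
conditional mean of \<open>x i\<close>. The conditional measure is itself a finite-volume Gibbs measure, in the volume \<open>\<Lambda> - A\<close>,
to which the hypothesis applies; by the field derivative again, the conditional mean is a Lipschitz function of the
coordinates in \<open>A\<close>, with constants given by the product of the covariance decay and the decay of \<open>M\<close>
(\<open>conditional_mean_lipschitz\<close>). Hence the covariance is small for every bounded \<open>f\<close>, smooth or not
(\<open>cov_bound_by_conditioning\<close>). Since both decay rates are summable, so is their convolution.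

Both uses of the field derivative need a uniform bound on the variances, which is not part of the hypotheses. It
follows from the covariance bound by contracting a single coordinate towards its mean, where the convexity of \<open>\<psi>c\<close>
and the boundedness of \<open>\<psi>b\<close> enter (\<open>variance_bound\<close>).
\<close>

section \<open>Integrals, sums and observables of exponential growth\<close>

abbreviation Leb :: "'i set \<Rightarrow> ('i \<Rightarrow> real) measure" where
  "Leb \<Lambda> \<equiv> PiM \<Lambda> (\<lambda>_. lborel)"

text \<open>
Observables whose integrals against every Boltzmann weight converge. Exponential growth, rather than polynomial, is allowed because differentiating in the external field produces
factors \<open>exp \<bar>h \<bullet> x\<bar>\<close>; the class is closed under all operations used below.
\<close>

definition moderate :: "'i set \<Rightarrow> (('i \<Rightarrow> real) \<Rightarrow> real) \<Rightarrow> bool" where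
  "moderate \<Lambda> f \<longleftrightarrow> f \<in> borel_measurable (Leb \<Lambda>) \<and>
     (\<exists>C c. 0 \<le> C \<and> 0 \<le> c \<and> (\<forall>x. \<bar>f x\<bar> \<le> C * exp (c * (\<Sum>i\<in>\<Lambda>. \<bar>x i\<bar>))))"

lemma moderateI:
  assumes "f \<in> borel_measurable (Leb \<Lambda>)" "0 \<le> C" "0 \<le> c"
    "\<And>x. \<bar>f x\<bar> \<le> C * exp (c * (\<Sum>i\<in>\<Lambda>. \<bar>x i\<bar>))"
  shows "moderate \<Lambda> f"
  using assms unfolding moderate_def by blast

lemma moderate_measurable [measurable_dest]: "moderate \<Lambda> f \<Longrightarrow> f \<in> borel_measurable (Leb \<Lambda>)"
  by (simp add: moderate_def)

lemma moderate_bounded: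
  assumes "f \<in> borel_measurable (Leb \<Lambda>)" "\<And>x. \<bar>f x\<bar> \<le> C"
  shows "moderate \<Lambda> f"
proof -
  have "0 \<le> C" using assms(2)[of undefined] by linarith
  then show ?thesis
    by (intro moderateI[where C = C and c = 0]) (use assms in auto)
qed

lemma moderate_const [intro, simp]: "moderate \<Lambda> (\<lambda>x. a)"
  by (rule moderate_bounded[where C = "\<bar>a\<bar>"]) auto

lemma moderate_add [intro]:
  assumes "moderate \<Lambda> f" "moderate \<Lambda> g"
  shows "moderate \<Lambda> (\<lambda>x. f x + g x)"
proof -
  obtain C c where C: "0 \<le> C" "0 \<le> c" "\<And>x. \<bar>f x\<bar> \<le> C * exp (c * (\<Sum>i\<in>\<Lambda>. \<bar>x i\<bar>))"
    using assms(1) unfolding moderate_def by blast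
  obtain D d where D: "0 \<le> D" "0 \<le> d" "\<And>x. \<bar>g x\<bar> \<le> D * exp (d * (\<Sum>i\<in>\<Lambda>. \<bar>x i\<bar>))"
    using assms(2) unfolding moderate_def by blast
  show ?thesis
  proof (rule moderateI[where C = "C + D" and c = "c + d"])
    fix x :: "'a \<Rightarrow> real"
    define s where "s = (\<Sum>i\<in>\<Lambda>. \<bar>x i\<bar>)"
    have s: "0 \<le> s" unfolding s_def by (simp add: sum_nonneg)
    have "\<bar>f x + g x\<bar> \<le> C * exp (c * s) + D * exp (d * s)"
      using C(3)[of x] D(3)[of x] unfolding s_def by linarith
    also have "\<dots> \<le> C * exp ((c + d) * s) + D * exp ((c + d) * s)"
      using C D s by (intro add_mono mult_left_mono) (auto intro!: mult_right_mono)
    finally show "\<bar>f x + g x\<bar> \<le> (C + D) * exp ((c + d) * (\<Sum>i\<in>\<Lambda>. \<bar>x i\<bar>))"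
      by (simp add: s_def algebra_simps)
  qed (use C D assms in \<open>auto dest!: moderate_measurable\<close>)
qed

lemma moderate_mult [intro]:
  assumes "moderate \<Lambda> f" "moderate \<Lambda> g"
  shows "moderate \<Lambda> (\<lambda>x. f x * g x)"
proof -
  obtain C c where C: "0 \<le> C" "0 \<le> c" "\<And>x. \<bar>f x\<bar> \<le> C * exp (c * (\<Sum>i\<in>\<Lambda>. \<bar>x i\<bar>))"
    using assms(1) unfolding moderate_def by blast
  obtain D d where D: "0 \<le> D" "0 \<le> d" "\<And>x. \<bar>g x\<bar> \<le> D * exp (d * (\<Sum>i\<in>\<Lambda>. \<bar>x i\<bar>))"
    using assms(2) unfolding moderate_def by blast
  show ?thesis
  proof (rule moderateI[where C = "C * D" and c = "c + d"])
    fix x :: "'a \<Rightarrow> real"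
    have "\<bar>f x * g x\<bar> \<le> (C * exp (c * (\<Sum>i\<in>\<Lambda>. \<bar>x i\<bar>))) * (D * exp (d * (\<Sum>i\<in>\<Lambda>. \<bar>x i\<bar>)))"
      unfolding abs_mult using C D by (intro mult_mono) auto
    then show "\<bar>f x * g x\<bar> \<le> (C * D) * exp ((c + d) * (\<Sum>i\<in>\<Lambda>. \<bar>x i\<bar>))"
      by (simp add: algebra_simps exp_add)
  qed (use C D assms in \<open>auto dest!: moderate_measurable\<close>)
qed

lemma moderate_diff [intro]:
  assumes "moderate \<Lambda> f" "moderate \<Lambda> g"
  shows "moderate \<Lambda> (\<lambda>x. f x - g x)"
  using moderate_add[OF assms(1) moderate_mult[OF moderate_const[of _ "-1"] assms(2)]] by simp

lemma moderate_abs [intro]: "moderate \<Lambda> f \<Longrightarrow> moderate \<Lambda> (\<lambda>x. \<bar>f x\<bar>)"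
  unfolding moderate_def by auto

lemma moderate_power2 [intro]: "moderate \<Lambda> f \<Longrightarrow> moderate \<Lambda> (\<lambda>x. (f x)\<^sup>2)"
  unfolding power2_eq_square by blast

lemma moderate_sum [intro]:
  assumes "\<And>i. i \<in> I \<Longrightarrow> moderate \<Lambda> (f i)"
  shows "moderate \<Lambda> (\<lambda>x. \<Sum>i\<in>I. f i x)"
  using assms by (induction I rule: infinite_finite_induct) auto

lemma moderate_coord [intro]:
  assumes "finite \<Lambda>" "i \<in> \<Lambda>"
  shows "moderate \<Lambda> (\<lambda>x. x i)"
proof (rule moderateI[where C = 1 and c = 1])
  show "(\<lambda>x. x i) \<in> borel_measurable (Leb \<Lambda>)"
    using measurable_component_singleton[OF assms(2), of "\<lambda>_. lborel"] by simp
  fix x :: "'a \<Rightarrow> real"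
  have "\<bar>x i\<bar> \<le> (\<Sum>i\<in>\<Lambda>. \<bar>x i\<bar>)" using assms by (intro member_le_sum) auto
  also have "\<dots> \<le> exp (\<Sum>i\<in>\<Lambda>. \<bar>x i\<bar>)" using exp_ge_add_one_self[of "\<Sum>i\<in>\<Lambda>. \<bar>x i\<bar>"] by linarith
  finally show "\<bar>x i\<bar> \<le> 1 * exp (1 * (\<Sum>i\<in>\<Lambda>. \<bar>x i\<bar>))" by simp
qed auto

lemma moderate_linear [intro]:
  assumes "finite \<Lambda>" shows "moderate \<Lambda> (\<lambda>x. \<Sum>i\<in>\<Lambda>. h i * x i)"
  using assms by (intro moderate_sum moderate_mult) auto

lemma moderate_exp_linear:
  assumes "finite \<Lambda>" shows "moderate \<Lambda> (\<lambda>x. exp \<bar>\<Sum>i\<in>\<Lambda>. h i * x i\<bar>)"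
proof (rule moderateI[where C = 1 and c = "\<Sum>i\<in>\<Lambda>. \<bar>h i\<bar>"])
  show "(\<lambda>x. exp \<bar>\<Sum>i\<in>\<Lambda>. h i * x i\<bar>) \<in> borel_measurable (Leb \<Lambda>)"
    using moderate_measurable[OF moderate_linear[OF assms, of h]] by measurable
  fix x :: "'a \<Rightarrow> real"
  have "\<bar>\<Sum>i\<in>\<Lambda>. h i * x i\<bar> \<le> (\<Sum>i\<in>\<Lambda>. \<bar>h i\<bar> * \<bar>x i\<bar>)"
    by (rule order_trans[OF sum_abs]) (simp add: abs_mult)
  also have "\<dots> \<le> (\<Sum>i\<in>\<Lambda>. (\<Sum>i\<in>\<Lambda>. \<bar>h i\<bar>) * \<bar>x i\<bar>)"
    using assms by (intro sum_mono mult_right_mono member_le_sum) auto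
  finally show "\<bar>exp \<bar>\<Sum>i\<in>\<Lambda>. h i * x i\<bar>\<bar> \<le> 1 * exp ((\<Sum>i\<in>\<Lambda>. \<bar>h i\<bar>) * (\<Sum>i\<in>\<Lambda>. \<bar>x i\<bar>))"
    by (simp add: sum_distrib_left)
qed (auto simp: sum_nonneg)

lemma integrable_gaussian_exp:
  fixes a :: real
  assumes "0 < a"
  shows "integrable lborel (\<lambda>x. exp (c * \<bar>x\<bar> - a * x\<^sup>2))"
proof -
  define \<sigma> where "\<sigma> = sqrt (1 / a)"
  have \<sigma>: "\<sigma> > 0" "\<sigma>\<^sup>2 = 1 / a" using assms by (auto simp: \<sigma>_def)
  have "integrable lborel (\<lambda>x. exp (c\<^sup>2 / (2 * a)) * (sqrt (2 * pi * \<sigma>\<^sup>2) * normal_density 0 \<sigma> x))"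
    using \<sigma> by (intro integrable_mult_right integrable_normal_density)
  moreover have "sqrt (2 * pi * \<sigma>\<^sup>2) * normal_density 0 \<sigma> x = exp (- (a / 2 * x\<^sup>2))" for x
    using \<sigma>(1) assms by (simp add: normal_density_def \<sigma>(2) mult.commute)
  then have "(\<lambda>x. exp (c\<^sup>2 / (2 * a)) * (sqrt (2 * pi * \<sigma>\<^sup>2) * normal_density 0 \<sigma> x)) =
             (\<lambda>x. exp (c\<^sup>2 / (2 * a) - a / 2 * x\<^sup>2))"
    by (simp add: exp_add[symmetric])
  ultimately have *: "integrable lborel (\<lambda>x. exp (c\<^sup>2 / (2 * a) - a / 2 * x\<^sup>2))" by simp
  \<comment> \<open>Completing the square absorbs the linear term into half of the quadratic one.\<close>
  have bd: "c * \<bar>x\<bar> - a * x\<^sup>2 \<le> c\<^sup>2 / (2 * a) - a / 2 * x\<^sup>2" for x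
  proof -
    have "0 \<le> (a * \<bar>x\<bar> - c)\<^sup>2 / (2 * a)" using assms by simp
    also have "\<dots> = c\<^sup>2 / (2 * a) - c * \<bar>x\<bar> + a / 2 * x\<^sup>2"
      using assms by (simp add: power2_diff power_mult_distrib field_simps power2_eq_square)
    finally show ?thesis by linarith
  qed
  show ?thesis
    by (rule Bochner_Integration.integrable_bound[OF *]) (use bd in auto)
qed

text \<open>
Differentiation under the integral sign will be done by integrating a second-order Taylor bound,
which delivers precisely this kind of estimate.
\<close>

lemma has_real_derivative_quadratic_error:
  fixes F :: "real \<Rightarrow> real"
  assumes "\<And>t. \<bar>t\<bar> \<le> 1 \<Longrightarrow> \<bar>F t - F 0 - t * D\<bar> \<le> K * t\<^sup>2"
  shows "(F has_real_derivative D) (at 0)"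
proof -
  have "((\<lambda>h. (F (0 + h) - F 0) / h - D) \<longlongrightarrow> 0) (at 0)"
  proof (rule Lim_null_comparison)
    show "\<forall>\<^sub>F h in at 0. norm ((F (0 + h) - F 0) / h - D) \<le> K * \<bar>h\<bar>"
      unfolding eventually_at
    proof (intro exI[of _ 1] conjI ballI impI)
      fix h :: real assume h: "h \<noteq> 0 \<and> dist h 0 < 1"
      then have "\<bar>F h - F 0 - h * D\<bar> / \<bar>h\<bar> \<le> K * h\<^sup>2 / \<bar>h\<bar>"
        using assms[of h] by (intro divide_right_mono) auto
      also have "K * h\<^sup>2 / \<bar>h\<bar> = K * \<bar>h\<bar>"
        using h by (simp add: power2_eq_square abs_if)
      also have "\<bar>F h - F 0 - h * D\<bar> / \<bar>h\<bar> = \<bar>(F (0 + h) - F 0) / h - D\<bar>"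
        using h by (simp add: abs_divide[symmetric] diff_divide_distrib)
      finally show "norm ((F (0 + h) - F 0) / h - D) \<le> K * \<bar>h\<bar>" by simp
    qed auto
    have "((\<lambda>h::real. K * \<bar>h\<bar>) \<longlongrightarrow> K * \<bar>0\<bar>) (at 0)" by (intro tendsto_intros)
    then show "((\<lambda>h::real. K * \<bar>h\<bar>) \<longlongrightarrow> 0) (at 0)" by simp
  qed
  then show ?thesis
    unfolding DERIV_def by (subst Lim_null)
qed

lemma exp_second_order:
  fixes z :: real
  shows "\<bar>exp z - 1 - z\<bar> \<le> z\<^sup>2 * exp \<bar>z\<bar>"
proof -
  obtain t where t: "\<bar>t\<bar> \<le> \<bar>z\<bar>" "exp z = (\<Sum>m<2. z ^ m / fact m) + exp t / fact 2 * z ^ 2"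
    using Maclaurin_exp_le[of z 2] by blast
  have "exp z - 1 - z = exp t / 2 * z\<^sup>2"
    using t(2) by (simp add: lessThan_nat_numeral numeral_2_eq_2)
  then have "\<bar>exp z - 1 - z\<bar> = exp t / 2 * z\<^sup>2" by (simp only: abs_mult) simp
  also have "\<dots> \<le> exp \<bar>z\<bar> * z\<^sup>2"
  proof (rule mult_right_mono)
    have "exp t \<le> exp \<bar>z\<bar>" using t(1) by auto
    then show "exp t / 2 \<le> exp \<bar>z\<bar>" using exp_gt_zero[of t] by linarith
  qed simp
  finally show ?thesis by (simp add: mult.commute)
qed

lemma integral_le_nn_integral:
  fixes f :: "'a \<Rightarrow> real"
  assumes "integrable N f"
  shows "ennreal (LINT x|N. f x) \<le> (\<integral>\<^sup>+x. ennreal (f x) \<partial>N)"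
proof -
  have "ennreal (LINT x|N. f x) \<le> ennreal (LINT x|N. max 0 (f x))"
    using assms by (intro ennreal_leI integral_mono integrable_max) auto
  also have "\<dots> = (\<integral>\<^sup>+x. ennreal (max 0 (f x)) \<partial>N)"
    using assms by (intro nn_integral_eq_integral[symmetric] integrable_max) auto
  also have "(\<lambda>x. ennreal (max 0 (f x))) = (\<lambda>x. ennreal (f x))"
    by (auto simp: ennreal_neg max_def fun_eq_iff)
  finally show ?thesis .
qed

text \<open>
Fubini in the form needed for conditioning: an inequality that holds after integrating out the
coordinates in \<open>B\<close>, for every value of those in \<open>A\<close>, survives the remaining integration.
\<close>

lemma abs_integral_le_by_slices:
  fixes F G :: "('i \<Rightarrow> real) \<Rightarrow> real"
  assumes fin: "finite A" "finite B" and disj: "A \<inter> B = {}"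
    and F: "integrable (Leb (A \<union> B)) F" and G: "integrable (Leb (A \<union> B)) G"
    and slice: "\<And>x. \<bar>LINT y|Leb B. F (merge A B (x, y))\<bar> \<le> (LINT y|Leb B. G (merge A B (x, y)))"
  shows "\<bar>LINT z|Leb (A \<union> B). F z\<bar> \<le> (LINT z|Leb (A \<union> B). G z)"
proof -
  interpret product_sigma_finite "\<lambda>_::'i. lborel :: real measure"
    by unfold_locales
  interpret A: finite_product_sigma_finite "\<lambda>_::'i. lborel :: real measure" A by standard (rule fin)
  interpret B: finite_product_sigma_finite "\<lambda>_::'i. lborel :: real measure" B by standard (rule fin)
  interpret P: pair_sigma_finite "Leb A" "Leb B" ..
  have fibre: "integrable (Leb A) (\<lambda>x. LINT y|Leb B. H (merge A B (x, y)))"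
    if H: "integrable (Leb (A \<union> B)) H" for H :: "('i \<Rightarrow> real) \<Rightarrow> real"
  proof -
    have "integrable (Leb A \<Otimes>\<^sub>M Leb B) (\<lambda>z. H (merge A B z))"
      by (rule integrable_distr[OF measurable_merge]) (simp add: distr_merge[OF disj fin] H)
    from P.integrable_fst'[OF this] show ?thesis .
  qed
  show ?thesis
    unfolding product_integral_fold[OF disj fin F] product_integral_fold[OF disj fin G]
    by (rule order_trans[OF integral_abs_bound], rule integral_mono)
       (use fibre[OF F] fibre[OF G] slice in auto)
qed

lemma has_sum_finite_sum:
  fixes f :: "'i \<Rightarrow> 'a \<Rightarrow> real"
  assumes "finite F" "\<And>i. i \<in> F \<Longrightarrow> (f i has_sum s i) A"
  shows "((\<lambda>x. \<Sum>i\<in>F. f i x) has_sum (\<Sum>i\<in>F. s i)) A"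
  using assms by (induction F rule: finite_induct) (auto intro!: has_sum_add has_sum_0)

lemma nn_integral_count_space_infsum:
  fixes f :: "'a \<Rightarrow> real"
  assumes "f summable_on A" "\<And>x. x \<in> A \<Longrightarrow> 0 \<le> f x"
  shows "(\<integral>\<^sup>+x. ennreal (f x) \<partial>count_space A) = ennreal (infsum f A)"
proof -
  have "(\<lambda>x. norm (f x)) summable_on A"
    using assms by (subst summable_on_cong[where g = f]) auto
  then have *: "Infinite_Set_Sum.abs_summable_on f A" by (simp only: abs_summable_equivalent)
  show ?thesis
    using nn_integral_conv_infsetsum[OF *] infsetsum_infsum[OF *] assms(2) by simp
qed

text \<open>
The tail is taken over the complement of an arbitrary superset \<open>G\<close> of \<open>F\<close>, so that several such
families can be controlled by one sufficiently large set.
\<close>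

lemma summable_on_small_tail:
  fixes f :: "'a \<Rightarrow> real"
  assumes "f summable_on A" and nn: "\<And>x. x \<in> A \<Longrightarrow> 0 \<le> f x" and "0 < \<epsilon>"
  obtains F where "finite F" "F \<subseteq> A" "\<And>G. F \<subseteq> G \<Longrightarrow> G \<subseteq> A \<Longrightarrow> infsum f (A - G) \<le> \<epsilon>"
proof -
  obtain F where F: "finite F" "F \<subseteq> A" "dist (sum f F) (infsum f A) \<le> \<epsilon>"
    using infsum_finite_approximation[OF assms(1,3)] by blast
  have "infsum f (A - G) \<le> \<epsilon>" if G: "F \<subseteq> G" "G \<subseteq> A" for G
  proof -
    have s: "f summable_on B" if "B \<subseteq> A" for B using summable_on_subset_banach[OF assms(1) that] .
    have "infsum f A = infsum f F + infsum f (A - F)"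
      using infsum_Un_disjoint[of f F "A - F"] s F by (simp add: Un_absorb1)
    moreover have "infsum f (A - G) \<le> infsum f (A - F)"
      using G nn by (intro infsum_mono2 s) auto
    ultimately show ?thesis using F by (simp add: dist_real_def)
  qed
  with F that show ?thesis by blast
qed

section \<open>Finite-volume Gibbs measures in an external field\<close>

text \<open>
The part of the hypotheses that acts inside a fixed finite volume. Diagonal dominance is therefore stated
through finite partial sums.
\<close>

locale spin_energy =
  fixes \<psi> \<psi>c \<psi>b :: "'i \<Rightarrow> real \<Rightarrow> real" and M :: "'i \<Rightarrow> 'i \<Rightarrow> real" and \<delta> C0 :: real
  assumes delta_pos: "0 < \<delta>"
    and psi_continuous: "\<And>i. continuous_on UNIV (\<psi> i)"
    and psi_split: "\<And>i z. \<psi> i z = \<psi>c i z + \<psi>b i z"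
    and psi_c_convex: "\<And>i. convex_on UNIV (\<psi>c i)"
    and psi_c_differentiable: "\<And>i z. \<psi>c i differentiable (at z)"
    and psi_b_bounded: "\<And>i z. \<bar>\<psi>b i z\<bar> \<le> C0"
    and M_symmetric: "\<And>i j. M i j = M j i"
    and M_dominant: "\<And>F i. finite F \<Longrightarrow> i \<notin> F \<Longrightarrow> (\<Sum>j\<in>F. \<bar>M i j\<bar>) + \<delta> \<le> M i i"
begin

text \<open>
A boundary condition acts on a finite volume only through the linear term that it adds to the energy.
Finite-volume measures are therefore indexed by an external field \<open>b\<close>. Conditioning on some of the
coordinates stays in this family: it merely changes the field.
\<close>

definition energy :: "'i set \<Rightarrow> ('i \<Rightarrow> real) \<Rightarrow> ('i \<Rightarrow> real) \<Rightarrow> real" where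
  "energy \<Lambda> b x = (\<Sum>i\<in>\<Lambda>. \<psi> i (x i)) + 1/2 * (\<Sum>i\<in>\<Lambda>. \<Sum>j\<in>\<Lambda>. M i j * x i * x j)
     + (\<Sum>i\<in>\<Lambda>. b i * x i)"

definition boltz :: "'i set \<Rightarrow> ('i \<Rightarrow> real) \<Rightarrow> ('i \<Rightarrow> real) \<Rightarrow> real" where
  "boltz \<Lambda> b x = exp (- energy \<Lambda> b x)"

definition partition_function :: "'i set \<Rightarrow> ('i \<Rightarrow> real) \<Rightarrow> real" where
  "partition_function \<Lambda> b = (LINT x|Leb \<Lambda>. boltz \<Lambda> b x)"

definition gibbs :: "'i set \<Rightarrow> ('i \<Rightarrow> real) \<Rightarrow> ('i \<Rightarrow> real) measure" where
  "gibbs \<Lambda> b = density (Leb \<Lambda>) (\<lambda>x. ennreal (boltz \<Lambda> b x / partition_function \<Lambda> b))"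

lemma boltz_pos: "0 < boltz \<Lambda> b x"
  by (simp add: boltz_def)

lemma C0_nonneg: "0 \<le> C0"
  using psi_b_bounded[of undefined 0] by linarith

lemma M_diag_ge: "\<delta> \<le> M i i"
  using M_dominant[of "{}" i] by simp

lemma psi_c_tangent: "\<psi>c i m + deriv (\<psi>c i) m * (z - m) \<le> \<psi>c i z"
proof -
  have "(\<psi>c i has_real_derivative deriv (\<psi>c i) m) (at m)"
    using psi_c_differentiable[of i m] by (metis DERIV_deriv_iff_real_differentiable)
  then show ?thesis
    using convex_on_imp_above_tangent[OF psi_c_convex[of i], of m z "deriv (\<psi>c i) m"] by auto
qed

lemma measurable_energy [measurable]: "energy \<Lambda> b \<in> borel_measurable (Leb \<Lambda>)"
proof -
  have [measurable]: "(\<lambda>x. x i) \<in> borel_measurable (Leb \<Lambda>)" if "i \<in> \<Lambda>" for i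
    using measurable_component_singleton[OF that, of "\<lambda>_. lborel"] by simp
  have [measurable]: "\<psi> i \<in> borel_measurable borel" for i
    by (rule borel_measurable_continuous_onI[OF psi_continuous])
  have [measurable]: "(\<lambda>x. \<psi> i (x i)) \<in> borel_measurable (Leb \<Lambda>)" if "i \<in> \<Lambda>" for i
    using that by measurable
  show ?thesis
    unfolding energy_def by (auto intro!: borel_measurable_sum borel_measurable_add borel_measurable_times)
qed

lemma measurable_boltz [measurable]: "boltz \<Lambda> b \<in> borel_measurable (Leb \<Lambda>)"
  unfolding boltz_def by measurable

text \<open>
By \<open>2 \<bar>x i\<bar> \<bar>x j\<bar> \<le> (x i)\<^sup>2 + (x j)\<^sup>2\<close> the off-diagonal part of the form costs at most the off-diagonal row sums,
and diagonal dominance leaves \<open>\<delta>\<close> at every site.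
\<close>

lemma quadratic_form_lower_bound:
  assumes "finite \<Lambda>"
  shows "\<delta> * (\<Sum>i\<in>\<Lambda>. (x i)\<^sup>2) \<le> (\<Sum>i\<in>\<Lambda>. \<Sum>j\<in>\<Lambda>. M i j * x i * x j)"
proof -
  define off where "off = (\<lambda>i j. if i = j then 0 else \<bar>M i j\<bar>)"
  have off_sym: "off i j = off j i" for i j by (simp add: off_def M_symmetric)
  have off_sum: "(\<Sum>j\<in>\<Lambda>. off i j) + \<delta> \<le> M i i" if "i \<in> \<Lambda>" for i
  proof -
    have "(\<Sum>j\<in>\<Lambda>. off i j) = (\<Sum>j\<in>\<Lambda> - {i}. \<bar>M i j\<bar>)"
      using assms that by (subst sum.remove[of \<Lambda> i]) (auto simp: off_def split: if_splits intro!: sum.cong)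
    then show ?thesis using M_dominant[of "\<Lambda> - {i}" i] assms by simp
  qed
  \<comment> \<open>By symmetry of the matrix both squares carry the same total weight.\<close>
  have "(\<Sum>i\<in>\<Lambda>. \<Sum>j\<in>\<Lambda>. off i j * ((x i)\<^sup>2 + (x j)\<^sup>2) / 2)
      = (\<Sum>i\<in>\<Lambda>. \<Sum>j\<in>\<Lambda>. off i j * (x i)\<^sup>2 / 2) + (\<Sum>i\<in>\<Lambda>. \<Sum>j\<in>\<Lambda>. off i j * (x j)\<^sup>2 / 2)"
    by (simp add: sum.distrib[symmetric] field_simps)
  also have "(\<Sum>i\<in>\<Lambda>. \<Sum>j\<in>\<Lambda>. off i j * (x j)\<^sup>2 / 2) = (\<Sum>i\<in>\<Lambda>. \<Sum>j\<in>\<Lambda>. off i j * (x i)\<^sup>2 / 2)"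
    by (subst sum.swap) (simp add: off_sym)
  finally have eq: "(\<Sum>i\<in>\<Lambda>. \<Sum>j\<in>\<Lambda>. off i j * ((x i)\<^sup>2 + (x j)\<^sup>2) / 2)
      = (\<Sum>i\<in>\<Lambda>. (\<Sum>j\<in>\<Lambda>. off i j) * (x i)\<^sup>2)"
    by (simp add: sum_distrib_right sum.distrib[symmetric])
  have "\<delta> * (\<Sum>i\<in>\<Lambda>. (x i)\<^sup>2) \<le> (\<Sum>i\<in>\<Lambda>. (M i i - (\<Sum>j\<in>\<Lambda>. off i j)) * (x i)\<^sup>2)"
    unfolding sum_distrib_left using off_sum by (intro sum_mono mult_right_mono) (force simp: algebra_simps)+
  also have "\<dots> = (\<Sum>i\<in>\<Lambda>. M i i * (x i)\<^sup>2) - (\<Sum>i\<in>\<Lambda>. \<Sum>j\<in>\<Lambda>. off i j * ((x i)\<^sup>2 + (x j)\<^sup>2) / 2)"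
    unfolding eq by (simp add: left_diff_distrib sum_subtractf)
  also have "(\<Sum>i\<in>\<Lambda>. M i i * (x i)\<^sup>2) = (\<Sum>i\<in>\<Lambda>. \<Sum>j\<in>\<Lambda>. if i = j then M i i * (x i)\<^sup>2 else 0)"
    using assms by simp
  also have "\<dots> - (\<Sum>i\<in>\<Lambda>. \<Sum>j\<in>\<Lambda>. off i j * ((x i)\<^sup>2 + (x j)\<^sup>2) / 2)
     = (\<Sum>i\<in>\<Lambda>. \<Sum>j\<in>\<Lambda>. (if i = j then M i i * (x i)\<^sup>2 else 0) - off i j * ((x i)\<^sup>2 + (x j)\<^sup>2) / 2)"
    by (simp add: sum_subtractf)
  also have "\<dots> \<le> (\<Sum>i\<in>\<Lambda>. \<Sum>j\<in>\<Lambda>. M i j * x i * x j)"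
  proof (intro sum_mono)
    fix i j
    have "2 * \<bar>x i * x j\<bar> \<le> (x i)\<^sup>2 + (x j)\<^sup>2"
      using sum_squares_bound[of "\<bar>x i\<bar>" "\<bar>x j\<bar>"] by (simp add: abs_mult)
    then have "\<bar>M i j\<bar> * (2 * \<bar>x i * x j\<bar>) \<le> \<bar>M i j\<bar> * ((x i)\<^sup>2 + (x j)\<^sup>2)"
      by (intro mult_left_mono) auto
    moreover have "- (M i j * x i * x j) \<le> \<bar>M i j\<bar> * \<bar>x i * x j\<bar>"
      by (metis abs_ge_minus_self abs_mult mult.assoc)
    ultimately show "(if i = j then M i i * (x i)\<^sup>2 else 0) - off i j * ((x i)\<^sup>2 + (x j)\<^sup>2) / 2
        \<le> M i j * x i * x j"
      by (auto simp: off_def power2_eq_square)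
  qed
  finally show ?thesis .
qed

text \<open>
The energy is bounded below by a sum of one-site terms: \<open>\<psi>c\<close> lies above its tangent at \<open>0\<close>,
\<open>\<psi>b\<close> is bounded, and the quadratic form contributes \<open>\<delta> / 2 * (x i)\<^sup>2\<close>. The weight is thus dominated
by a product of Gaussians with linear exponents.
\<close>

lemma integrable_exp_boltz:
  assumes "finite \<Lambda>"
  shows "integrable (Leb \<Lambda>) (\<lambda>x. exp (c * (\<Sum>i\<in>\<Lambda>. \<bar>x i\<bar>)) * boltz \<Lambda> b x)"
proof -
  interpret product_sigma_finite "\<lambda>_::'i. lborel :: real measure"
    by unfold_locales
  define g where "g = (\<lambda>i z. exp (C0 - \<psi>c i 0) *
     exp ((c + \<bar>deriv (\<psi>c i) 0\<bar> + \<bar>b i\<bar>) * \<bar>z\<bar> - \<delta> / 2 * z\<^sup>2))"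
  have "integrable lborel (g i)" for i
    unfolding g_def using delta_pos by (intro integrable_mult_right integrable_gaussian_exp) simp
  then have *: "integrable (Leb \<Lambda>) (\<lambda>x. \<Prod>i\<in>\<Lambda>. g i (x i))"
    using assms by (intro product_integrable_prod)
  show ?thesis
  proof (rule Bochner_Integration.integrable_bound[OF *])
    have [measurable]: "(\<lambda>x. x i) \<in> borel_measurable (Leb \<Lambda>)" if "i \<in> \<Lambda>" for i
      using measurable_component_singleton[OF that, of "\<lambda>_. lborel"] by simp
    show "(\<lambda>x. exp (c * (\<Sum>i\<in>\<Lambda>. \<bar>x i\<bar>)) * boltz \<Lambda> b x) \<in> borel_measurable (Leb \<Lambda>)"
      by measurable
    show "AE x in Leb \<Lambda>. norm (exp (c * (\<Sum>i\<in>\<Lambda>. \<bar>x i\<bar>)) * boltz \<Lambda> b x) \<le> norm (\<Prod>i\<in>\<Lambda>. g i (x i))"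
    proof (intro AE_I2)
      fix x :: "'i \<Rightarrow> real"
      have site: "\<psi>c i 0 - C0 - \<bar>deriv (\<psi>c i) 0\<bar> * \<bar>x i\<bar> - \<bar>b i\<bar> * \<bar>x i\<bar> \<le> \<psi> i (x i) + b i * x i" for i
      proof -
        have "\<psi>c i 0 + deriv (\<psi>c i) 0 * x i \<le> \<psi>c i (x i)" using psi_c_tangent[of i 0 "x i"] by simp
        moreover have "- (\<bar>deriv (\<psi>c i) 0\<bar> * \<bar>x i\<bar>) \<le> deriv (\<psi>c i) 0 * x i"
          by (metis abs_ge_minus_self abs_mult minus_le_iff)
        moreover have "- (\<bar>b i\<bar> * \<bar>x i\<bar>) \<le> b i * x i"
          by (metis abs_ge_minus_self abs_mult minus_le_iff)
        ultimately show ?thesis using psi_b_bounded[of i "x i"] psi_split[of i "x i"] by linarith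
      qed
      have "(\<Sum>i\<in>\<Lambda>. \<psi>c i 0 - C0 - \<bar>deriv (\<psi>c i) 0\<bar> * \<bar>x i\<bar> - \<bar>b i\<bar> * \<bar>x i\<bar>) \<le> (\<Sum>i\<in>\<Lambda>. \<psi> i (x i) + b i * x i)"
        by (intro sum_mono site)
      then have "(\<Sum>i\<in>\<Lambda>. \<psi>c i 0 - C0 - \<bar>deriv (\<psi>c i) 0\<bar> * \<bar>x i\<bar> - \<bar>b i\<bar> * \<bar>x i\<bar>)
          + (\<Sum>i\<in>\<Lambda>. \<delta> / 2 * (x i)\<^sup>2) \<le> energy \<Lambda> b x"
        using quadratic_form_lower_bound[OF assms, of x]
        by (simp add: energy_def sum.distrib) (simp add: sum_distrib_left sum_divide_distrib[symmetric])
      then have "c * (\<Sum>i\<in>\<Lambda>. \<bar>x i\<bar>) - energy \<Lambda> b x \<le>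
          (\<Sum>i\<in>\<Lambda>. c * \<bar>x i\<bar>) - ((\<Sum>i\<in>\<Lambda>. \<psi>c i 0 - C0 - \<bar>deriv (\<psi>c i) 0\<bar> * \<bar>x i\<bar> - \<bar>b i\<bar> * \<bar>x i\<bar>)
          + (\<Sum>i\<in>\<Lambda>. \<delta> / 2 * (x i)\<^sup>2))"
        by (simp add: sum_distrib_left)
      also have "\<dots> = (\<Sum>i\<in>\<Lambda>. (C0 - \<psi>c i 0) + ((c + \<bar>deriv (\<psi>c i) 0\<bar> + \<bar>b i\<bar>) * \<bar>x i\<bar> - \<delta> / 2 * (x i)\<^sup>2))"
        by (simp add: sum_subtractf[symmetric] sum.distrib[symmetric] algebra_simps)
      finally have "exp (c * (\<Sum>i\<in>\<Lambda>. \<bar>x i\<bar>) - energy \<Lambda> b x) \<le> exp \<dots>" by simp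
      also have "\<dots> = (\<Prod>i\<in>\<Lambda>. g i (x i))"
        using assms by (simp add: exp_sum g_def exp_add)
      finally show "norm (exp (c * (\<Sum>i\<in>\<Lambda>. \<bar>x i\<bar>)) * boltz \<Lambda> b x) \<le> norm (\<Prod>i\<in>\<Lambda>. g i (x i))"
        by (simp add: boltz_def exp_diff exp_minus divide_inverse)
    qed
  qed
qed

lemma integrable_boltz:
  assumes "finite \<Lambda>" "moderate \<Lambda> f"
  shows "integrable (Leb \<Lambda>) (\<lambda>x. f x * boltz \<Lambda> b x)"
proof -
  obtain C c where C: "0 \<le> C" "\<And>x. \<bar>f x\<bar> \<le> C * exp (c * (\<Sum>i\<in>\<Lambda>. \<bar>x i\<bar>))"
    using assms(2) unfolding moderate_def by blast
  have [measurable]: "f \<in> borel_measurable (Leb \<Lambda>)" using assms(2) by (rule moderate_measurable)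
  show ?thesis
  proof (rule Bochner_Integration.integrable_bound)
    show "integrable (Leb \<Lambda>) (\<lambda>x. C * (exp (c * (\<Sum>i\<in>\<Lambda>. \<bar>x i\<bar>)) * boltz \<Lambda> b x))"
      by (intro integrable_mult_right integrable_exp_boltz assms)
    show "AE x in Leb \<Lambda>. norm (f x * boltz \<Lambda> b x)
        \<le> norm (C * (exp (c * (\<Sum>i\<in>\<Lambda>. \<bar>x i\<bar>)) * boltz \<Lambda> b x))"
    proof (intro AE_I2)
      fix x :: "'i \<Rightarrow> real"
      have "\<bar>f x\<bar> * boltz \<Lambda> b x \<le> (C * exp (c * (\<Sum>i\<in>\<Lambda>. \<bar>x i\<bar>))) * boltz \<Lambda> b x"
        using boltz_pos[of \<Lambda> b x] C by (intro mult_right_mono) auto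
      then show "norm (f x * boltz \<Lambda> b x) \<le> norm (C * (exp (c * (\<Sum>i\<in>\<Lambda>. \<bar>x i\<bar>)) * boltz \<Lambda> b x))"
        using boltz_pos[of \<Lambda> b x] C(1) by (simp add: abs_mult mult.assoc)
    qed
  qed measurable
qed

lemma integrable_boltz': "finite \<Lambda> \<Longrightarrow> integrable (Leb \<Lambda>) (boltz \<Lambda> b)"
  using integrable_boltz[of \<Lambda> "\<lambda>_. 1" b] by simp

lemma partition_function_pos:
  assumes "finite \<Lambda>" shows "0 < partition_function \<Lambda> b"
proof -
  interpret product_sigma_finite "\<lambda>_::'i. lborel :: real measure"
    by unfold_locales
  have nn: "0 \<le> partition_function \<Lambda> b"
    unfolding partition_function_def using boltz_pos by (intro integral_nonneg_AE AE_I2) (simp add: less_imp_le)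
  have "partition_function \<Lambda> b \<noteq> 0"
  proof
    assume "partition_function \<Lambda> b = 0"
    then have "AE x in Leb \<Lambda>. boltz \<Lambda> b x = 0"
      unfolding partition_function_def using integral_nonneg_eq_0_iff_AE[OF integrable_boltz'[OF assms, of b]] boltz_pos
      by (auto simp: less_imp_le)
    then have "AE x in Leb \<Lambda>. False" using boltz_pos by (simp add: less_imp_neq[symmetric])
    then have "emeasure (Leb \<Lambda>) (space (Leb \<Lambda>)) = 0" by (simp add: AE_iff_measurable[OF _ refl] )
    \<comment> \<open>The unit cube has measure 1, so the whole space is not a null set.\<close>
    moreover have "emeasure (Leb \<Lambda>) (\<Pi>\<^sub>E i\<in>\<Lambda>. {0..1}) = 1"
      using assms by (subst emeasure_PiM) auto
    ultimately show False
      by (metis emeasure_space le_zero_eq zero_neq_one)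
  qed
  with nn show ?thesis by simp
qed

lemma sets_gibbs [measurable_cong]: "sets (gibbs \<Lambda> b) = sets (Leb \<Lambda>)"
  by (simp add: gibbs_def)

lemma
  assumes "finite \<Lambda>" "moderate \<Lambda> f"
  shows integrable_gibbs: "integrable (gibbs \<Lambda> b) f"
    and integral_gibbs: "(LINT x|gibbs \<Lambda> b. f x) = (LINT x|Leb \<Lambda>. f x * boltz \<Lambda> b x) / partition_function \<Lambda> b"
proof -
  have [measurable]: "f \<in> borel_measurable (Leb \<Lambda>)" using assms(2) by (rule moderate_measurable)
  have nn: "0 \<le> boltz \<Lambda> b x / partition_function \<Lambda> b" for x
    using boltz_pos[of \<Lambda> b x] partition_function_pos[OF assms(1), of b] by simp
  have eq: "(\<lambda>x. (boltz \<Lambda> b x / partition_function \<Lambda> b) *\<^sub>R f x) = (\<lambda>x. (f x * boltz \<Lambda> b x) / partition_function \<Lambda> b)"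
    by (auto simp: field_simps)
  show "integrable (gibbs \<Lambda> b) f"
    unfolding gibbs_def using nn
    by (subst integrable_density) (auto simp: eq simp del: real_scaleR_def intro!: integrable_divide integrable_boltz assms)
  show "(LINT x|gibbs \<Lambda> b. f x) = (LINT x|Leb \<Lambda>. f x * boltz \<Lambda> b x) / partition_function \<Lambda> b"
    unfolding gibbs_def using nn by (subst integral_density) (auto simp: eq simp del: real_scaleR_def)
qed

lemma prob_space_gibbs:
  assumes "finite \<Lambda>" shows "prob_space (gibbs \<Lambda> b)"
proof
  have "emeasure (gibbs \<Lambda> b) (space (gibbs \<Lambda> b)) = (\<integral>\<^sup>+x. ennreal (boltz \<Lambda> b x / partition_function \<Lambda> b) \<partial>Leb \<Lambda>)"
    by (simp add: gibbs_def emeasure_density nn_integral_set_ennreal[symmetric] cong: nn_integral_cong_simp)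
  also have "\<dots> = ennreal (LINT x|Leb \<Lambda>. boltz \<Lambda> b x / partition_function \<Lambda> b)"
    using integrable_boltz'[OF assms, of b] boltz_pos[of \<Lambda> b] partition_function_pos[OF assms, of b]
    by (intro nn_integral_eq_integral) (auto intro!: AE_I2 divide_nonneg_pos intro: less_imp_le)
  also have "\<dots> = 1"
    using partition_function_pos[OF assms, of b] by (simp add: partition_function_def)
  finally show "emeasure (gibbs \<Lambda> b) (space (gibbs \<Lambda> b)) = 1" .
qed

text \<open>
Only one factor has to be centred; the constant \<open>c\<close> subtracted from the other is free.
\<close>

lemma cov_centred:
  assumes fin: "finite \<Lambda>" and f: "moderate \<Lambda> f" and g: "moderate \<Lambda> g"
  shows "cov (gibbs \<Lambda> b) f g = (LINT x|gibbs \<Lambda> b. (f x - (LINT x|gibbs \<Lambda> b. f x)) * (g x - c))"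
proof -
  interpret prob_space "gibbs \<Lambda> b" using fin by (rule prob_space_gibbs)
  note int = integrable_gibbs[OF fin, where b = b]
  define m where "m = (LINT x|gibbs \<Lambda> b. f x)"
  have "(LINT x|gibbs \<Lambda> b. (f x - m) * (g x - c)) = (LINT x|gibbs \<Lambda> b. f x * g x - m * g x - c * f x + m * c)"
    by (simp add: algebra_simps)
  also have "\<dots> = (LINT x|gibbs \<Lambda> b. f x * g x) - m * (LINT x|gibbs \<Lambda> b. g x) - c * m + m * c"
    using int[OF f] int[OF g] int[OF moderate_mult[OF f g]] by (simp add: m_def prob_space)
  finally show ?thesis by (simp add: cov_def m_def)
qed

section \<open>Dependence of expectations on the field\<close>

lemma boltz_tilt:
  "boltz \<Lambda> (\<lambda>i. b i + t * h i) x = boltz \<Lambda> b x * exp (- (t * (\<Sum>i\<in>\<Lambda>. h i * x i)))"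
  by (simp add: boltz_def energy_def exp_add[symmetric] algebra_simps sum.distrib sum_distrib_left)

text \<open>
Tilting the field by \<open>t * h\<close> multiplies the weight by \<open>exp (- t * L x)\<close> with \<open>L x = h \<bullet> x\<close>. For
\<open>\<bar>t\<bar> \<le> 1\<close> the second-order remainder is at most \<open>t\<^sup>2 * (L x)\<^sup>2 * exp \<bar>L x\<bar>\<close>, which is integrable against
the weight. The derivative at a general \<open>s\<close> is the one at \<open>0\<close> for the field \<open>b + s * h\<close>.
\<close>

lemma has_real_derivative_boltz_integral:
  assumes fin: "finite \<Lambda>" and f: "moderate \<Lambda> f"
  shows "((\<lambda>t. LINT x|Leb \<Lambda>. f x * boltz \<Lambda> (\<lambda>i. b i + t * h i) x) has_real_derivative
     - (LINT x|Leb \<Lambda>. f x * (\<Sum>i\<in>\<Lambda>. h i * x i) * boltz \<Lambda> (\<lambda>i. b i + s * h i) x)) (at s)"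
proof -
  define L where "L = (\<lambda>x. \<Sum>i\<in>\<Lambda>. h i * x i)"
  define b' where "b' = (\<lambda>i. b i + s * h i)"
  have L: "moderate \<Lambda> L" unfolding L_def using fin by blast
  have eL: "moderate \<Lambda> (\<lambda>x. exp \<bar>L x\<bar>)" unfolding L_def using fin by (rule moderate_exp_linear)
  define g where "g = (\<lambda>x. \<bar>f x\<bar> * (L x)\<^sup>2 * exp \<bar>L x\<bar>)"
  have g: "moderate \<Lambda> g"
    unfolding g_def by (intro moderate_mult moderate_abs moderate_power2 f L eL)
  have "((\<lambda>t. LINT x|Leb \<Lambda>. f x * boltz \<Lambda> (\<lambda>i. b' i + t * h i) x) has_real_derivative
     - (LINT x|Leb \<Lambda>. f x * L x * boltz \<Lambda> b' x)) (at 0)"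
  proof (rule has_real_derivative_quadratic_error[where K = "LINT x|Leb \<Lambda>. g x * boltz \<Lambda> b' x"])
    fix t :: real assume t: "\<bar>t\<bar> \<le> 1"
    have int: "integrable (Leb \<Lambda>) (\<lambda>x. f x * boltz \<Lambda> b'' x)"
              "integrable (Leb \<Lambda>) (\<lambda>x. f x * L x * boltz \<Lambda> b'' x)" for b''
      by (intro integrable_boltz fin f moderate_mult L)+
    have "\<bar>(LINT x|Leb \<Lambda>. f x * boltz \<Lambda> (\<lambda>i. b' i + t * h i) x)
         - (LINT x|Leb \<Lambda>. f x * boltz \<Lambda> (\<lambda>i. b' i + 0 * h i) x)
         - t * - (LINT x|Leb \<Lambda>. f x * L x * boltz \<Lambda> b' x)\<bar>
      = \<bar>LINT x|Leb \<Lambda>. f x * boltz \<Lambda> (\<lambda>i. b' i + t * h i) x - f x * boltz \<Lambda> b' x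
           + t * (f x * L x * boltz \<Lambda> b' x)\<bar>"
      using int by simp
    also have "\<dots> \<le> (LINT x|Leb \<Lambda>. \<bar>f x * boltz \<Lambda> (\<lambda>i. b' i + t * h i) x - f x * boltz \<Lambda> b' x
           + t * (f x * L x * boltz \<Lambda> b' x)\<bar>)"
      by (rule integral_abs_bound)
    also have "\<dots> \<le> (LINT x|Leb \<Lambda>. t\<^sup>2 * (g x * boltz \<Lambda> b' x))"
    proof (rule integral_mono)
      show "integrable (Leb \<Lambda>) (\<lambda>x. t\<^sup>2 * (g x * boltz \<Lambda> b' x))"
        by (intro integrable_mult_right integrable_boltz fin g)
      fix x :: "'i \<Rightarrow> real"
      define z where "z = - (t * L x)"
      have zL: "\<bar>z\<bar> \<le> \<bar>L x\<bar>" using t by (simp add: z_def abs_mult mult_left_le_one_le)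
      have tilt: "boltz \<Lambda> (\<lambda>i. b' i + t * h i) x = boltz \<Lambda> b' x * exp z"
        by (simp add: boltz_tilt z_def L_def)
      have "\<bar>f x * boltz \<Lambda> (\<lambda>i. b' i + t * h i) x - f x * boltz \<Lambda> b' x + t * (f x * L x * boltz \<Lambda> b' x)\<bar>
         = \<bar>f x * boltz \<Lambda> b' x * (exp z - 1 - z)\<bar>"
        unfolding tilt by (simp add: z_def algebra_simps)
      also have "\<dots> = \<bar>f x\<bar> * boltz \<Lambda> b' x * \<bar>exp z - 1 - z\<bar>"
        using boltz_pos[of \<Lambda> b' x] by (simp add: abs_mult)
      also have "\<dots> \<le> \<bar>f x\<bar> * boltz \<Lambda> b' x * (t\<^sup>2 * (L x)\<^sup>2 * exp \<bar>L x\<bar>)"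
      proof (rule mult_left_mono)
        have "\<bar>exp z - 1 - z\<bar> \<le> z\<^sup>2 * exp \<bar>z\<bar>" by (rule exp_second_order)
        also have "\<dots> \<le> z\<^sup>2 * exp \<bar>L x\<bar>" using zL by (intro mult_left_mono) auto
        finally show "\<bar>exp z - 1 - z\<bar> \<le> t\<^sup>2 * (L x)\<^sup>2 * exp \<bar>L x\<bar>"
          by (simp add: z_def power_mult_distrib)
      qed (use boltz_pos[of \<Lambda> b' x] in simp)
      finally show "\<bar>f x * boltz \<Lambda> (\<lambda>i. b' i + t * h i) x - f x * boltz \<Lambda> b' x + t * (f x * L x * boltz \<Lambda> b' x)\<bar>
          \<le> t\<^sup>2 * (g x * boltz \<Lambda> b' x)"
        by (simp add: g_def mult_ac)
    qed (use int in auto)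
    finally show "\<bar>(LINT x|Leb \<Lambda>. f x * boltz \<Lambda> (\<lambda>i. b' i + t * h i) x)
         - (LINT x|Leb \<Lambda>. f x * boltz \<Lambda> (\<lambda>i. b' i + 0 * h i) x)
         - t * - (LINT x|Leb \<Lambda>. f x * L x * boltz \<Lambda> b' x)\<bar>
         \<le> (LINT x|Leb \<Lambda>. g x * boltz \<Lambda> b' x) * t\<^sup>2"
      by (simp add: mult.commute)
  qed
  moreover have "b' i + t * h i = b i + (s + t) * h i" for i t
    by (simp add: b'_def algebra_simps)
  ultimately show ?thesis
    unfolding L_def b'_def[symmetric]
    using DERIV_shift[of "\<lambda>t. LINT x|Leb \<Lambda>. f x * boltz \<Lambda> (\<lambda>i. b i + t * h i) x" _ 0 s]
    by (simp add: add.commute)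
qed

text \<open>
The quotient rule: the numerator and the partition function each bring down a factor \<open>- L\<close>, and the
two contributions combine to a covariance.
\<close>

lemma has_real_derivative_gibbs:
  assumes fin: "finite \<Lambda>" and f: "moderate \<Lambda> f"
  shows "((\<lambda>t. LINT x|gibbs \<Lambda> (\<lambda>i. b i + t * h i). f x) has_real_derivative
     - cov (gibbs \<Lambda> (\<lambda>i. b i + s * h i)) f (\<lambda>x. \<Sum>i\<in>\<Lambda>. h i * x i)) (at s)"
proof -
  define L where "L = (\<lambda>x. \<Sum>i\<in>\<Lambda>. h i * x i)"
  have L: "moderate \<Lambda> L" unfolding L_def using fin by blast
  define b' where "b' = (\<lambda>i. b i + s * h i)"
  define N where "N = (\<lambda>f t. LINT x|Leb \<Lambda>. f x * boltz \<Lambda> (\<lambda>i. b i + t * h i) x)"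
  have part: "partition_function \<Lambda> (\<lambda>i. b i + t * h i) = N (\<lambda>_. 1) t" for t
    by (simp add: partition_function_def N_def)
  have pos: "N (\<lambda>_. 1) t \<noteq> 0" for t
    using partition_function_pos[OF fin, of "\<lambda>i. b i + t * h i"] by (simp add: part)
  have der: "(N u has_real_derivative - N (\<lambda>x. u x * L x) s) (at s)" if "moderate \<Lambda> u" for u
    using has_real_derivative_boltz_integral[OF fin that, of b h s] by (simp add: N_def L_def)
  have "((\<lambda>t. N f t / N (\<lambda>_. 1) t) has_real_derivative
      (- N (\<lambda>x. f x * L x) s * N (\<lambda>_. 1) s - N f s * - N (\<lambda>x. 1 * L x) s) / (N (\<lambda>_. 1) s * N (\<lambda>_. 1) s)) (at s)"
    by (intro DERIV_divide der f moderate_const pos)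
  moreover have "(- N (\<lambda>x. f x * L x) s * N (\<lambda>_. 1) s - N f s * - N (\<lambda>x. 1 * L x) s) / (N (\<lambda>_. 1) s * N (\<lambda>_. 1) s)
     = - (N (\<lambda>x. f x * L x) s / N (\<lambda>_. 1) s - (N f s / N (\<lambda>_. 1) s) * (N L s / N (\<lambda>_. 1) s))"
    using pos[of s] by (simp add: field_simps)
  moreover have "(LINT x|gibbs \<Lambda> (\<lambda>i. b i + t * h i). u x) = N u t / N (\<lambda>_. 1) t" if "moderate \<Lambda> u" for u t
    using integral_gibbs[OF fin that] by (simp add: part) (simp add: N_def)
  ultimately show ?thesis
    using f L by (simp add: cov_def moderate_mult L_def[symmetric])
qed

lemma cov_linear_right:
  assumes fin: "finite \<Lambda>" and f: "moderate \<Lambda> f"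
  shows "cov (gibbs \<Lambda> b) f (\<lambda>x. \<Sum>i\<in>\<Lambda>. h i * x i) = (\<Sum>i\<in>\<Lambda>. h i * cov (gibbs \<Lambda> b) f (\<lambda>x. x i))"
proof -
  have int: "integrable (gibbs \<Lambda> b) (\<lambda>x. x i)" "integrable (gibbs \<Lambda> b) (\<lambda>x. f x * x i)" if "i \<in> \<Lambda>" for i
    using that by (auto intro!: integrable_gibbs fin f)
  have "(LINT x|gibbs \<Lambda> b. (\<Sum>i\<in>\<Lambda>. h i * x i)) = (\<Sum>i\<in>\<Lambda>. h i * (LINT x|gibbs \<Lambda> b. x i))"
    using int by (subst Bochner_Integration.integral_sum) auto
  moreover have "(LINT x|gibbs \<Lambda> b. f x * (\<Sum>i\<in>\<Lambda>. h i * x i)) = (LINT x|gibbs \<Lambda> b. (\<Sum>i\<in>\<Lambda>. h i * (f x * x i)))"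
    by (simp add: sum_distrib_left mult_ac)
  moreover have "\<dots> = (\<Sum>i\<in>\<Lambda>. h i * (LINT x|gibbs \<Lambda> b. f x * x i))"
    using int by (subst Bochner_Integration.integral_sum) auto
  ultimately show ?thesis
    by (simp add: cov_def sum_subtractf right_diff_distrib sum_distrib_left mult_ac)
qed

text \<open>
The mean value theorem along the segment from \<open>b\<close> to \<open>b'\<close>. It serves twice: it is
applied to a coordinate inside a conditional measure, and to a local function when the boundary values
are switched on.
\<close>

lemma gibbs_field_comparison:
  assumes fin: "finite \<Lambda>" and f: "moderate \<Lambda> f"
    and cov: "\<And>t j. 0 \<le> t \<Longrightarrow> t \<le> 1 \<Longrightarrow> j \<in> \<Lambda> \<Longrightarrow>
        \<bar>cov (gibbs \<Lambda> (\<lambda>i. b i + t * (b' i - b i))) f (\<lambda>x. x j)\<bar> \<le> c j"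
  shows "\<bar>(LINT x|gibbs \<Lambda> b'. f x) - (LINT x|gibbs \<Lambda> b. f x)\<bar> \<le> (\<Sum>j\<in>\<Lambda>. c j * \<bar>b' j - b j\<bar>)"
proof -
  define \<Phi> where "\<Phi> = (\<lambda>t. LINT x|gibbs \<Lambda> (\<lambda>i. b i + t * (b' i - b i)). f x)"
  obtain s where s: "0 < s" "s < 1" "\<Phi> 1 - \<Phi> 0 = (1 - 0) *
      (- cov (gibbs \<Lambda> (\<lambda>i. b i + s * (b' i - b i))) f (\<lambda>x. \<Sum>i\<in>\<Lambda>. (b' i - b i) * x i))"
    unfolding \<Phi>_def using MVT2[OF _ has_real_derivative_gibbs[OF fin f, of b "\<lambda>i. b' i - b i"], of 0 1]
    by auto
  have "\<bar>\<Phi> 1 - \<Phi> 0\<bar> \<le> (\<Sum>j\<in>\<Lambda>. \<bar>(b' j - b j) * cov (gibbs \<Lambda> (\<lambda>i. b i + s * (b' i - b i))) f (\<lambda>x. x j)\<bar>)"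
    unfolding s(3) cov_linear_right[OF fin f] by (simp add: sum_abs)
  also have "\<dots> \<le> (\<Sum>j\<in>\<Lambda>. c j * \<bar>b' j - b j\<bar>)"
    using cov[of s] s by (intro sum_mono) (auto simp: abs_mult mult.commute[of "c _"] intro!: mult_left_mono)
  finally show ?thesis by (simp add: \<Phi>_def)
qed

section \<open>Variances\<close>

text \<open>
The Jacobian of the contraction of one coordinate towards \<open>m\<close>, used in the variance bound.
\<close>

lemma nn_integral_halve_coordinate:
  fixes f :: "('i \<Rightarrow> real) \<Rightarrow> ennreal"
  assumes fin: "finite \<Lambda>" and i: "i \<in> \<Lambda>" and f [measurable]: "f \<in> borel_measurable (Leb \<Lambda>)"
  shows "(\<integral>\<^sup>+x. f (x(i := (m + x i) / 2)) \<partial>Leb \<Lambda>) = 2 * (\<integral>\<^sup>+x. f x \<partial>Leb \<Lambda>)"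
proof -
  interpret product_sigma_finite "\<lambda>_::'i. lborel :: real measure"
    by unfold_locales
  define I where "I = \<Lambda> - {i}"
  have I: "finite I" "i \<notin> I" "\<Lambda> = insert i I" using fin i by (auto simp: I_def)
  note f' = f[unfolded I(3)]
  have [measurable]: "(\<lambda>x. x(i := (m + x i) / 2)) \<in> measurable (Leb (insert i I)) (Leb (insert i I))"
  proof (rule measurable_PiM_single')
    fix j assume j: "j \<in> insert i I"
    show "(\<lambda>x. (x(i := (m + x i) / 2)) j) \<in> measurable (Leb (insert i I)) lborel"
      using measurable_component_singleton[OF j, of "\<lambda>_. lborel"]
        measurable_component_singleton[of i "insert i I" "\<lambda>_. lborel"]
      by (cases "j = i") simp_all
  qed (auto simp: space_PiM PiE_def extensional_def)
  have line: "(\<integral>\<^sup>+y. f (x(i := (m + y) / 2)) \<partial>lborel) = 2 * (\<integral>\<^sup>+y. f (x(i := y)) \<partial>lborel)"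
    if x: "x \<in> space (Leb I)" for x
  proof -
    have [measurable]: "(\<lambda>y. f (x(i := y))) \<in> borel_measurable borel"
      using measurable_comp[OF measurable_component_update f', OF x I(2)] unfolding comp_def by simp
    have "(\<integral>\<^sup>+y. f (x(i := y)) \<partial>lborel) = ennreal \<bar>1/2\<bar> * (\<integral>\<^sup>+y. f (x(i := m / 2 + 1/2 * y)) \<partial>lborel)"
      by (rule nn_integral_real_affine) auto
    moreover have "m / 2 + 1/2 * y = (m + y) / 2" for y by simp
    ultimately have "2 * (\<integral>\<^sup>+y. f (x(i := y)) \<partial>lborel)
        = (2 * ennreal (1/2)) * (\<integral>\<^sup>+y. f (x(i := (m + y) / 2)) \<partial>lborel)"
      by (simp add: mult.assoc add_divide_distrib)
    also have "2 * ennreal (1/2) = 1"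
      by (metis ennreal_1 ennreal_mult' ennreal_numeral nonzero_mult_div_cancel_left numeral_le_iff one_add_one times_divide_eq_right zero_le_numeral zero_neq_numeral mult.right_neutral)
    finally show ?thesis by (simp only: mult_1)
  qed
  have "(\<integral>\<^sup>+x. f (x(i := (m + x i) / 2)) \<partial>Leb \<Lambda>)
     = (\<integral>\<^sup>+x. (\<integral>\<^sup>+y. f (x(i := (m + y) / 2)) \<partial>lborel) \<partial>Leb I)"
    unfolding I(3) by (subst product_nn_integral_insert) (use I f' in \<open>auto simp: fun_upd_upd\<close>)
  also have "\<dots> = (\<integral>\<^sup>+x. 2 * (\<integral>\<^sup>+y. f (x(i := y)) \<partial>lborel) \<partial>Leb I)"
    by (intro nn_integral_cong line)
  also have "\<dots> = 2 * (\<integral>\<^sup>+x. (\<integral>\<^sup>+y. f (x(i := y)) \<partial>lborel) \<partial>Leb I)"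
  proof (rule nn_integral_cmult)
    have "(\<lambda>z. f ((fst z)(i := snd z))) \<in> borel_measurable (Leb I \<Otimes>\<^sub>M lborel)"
      using measurable_comp[OF measurable_add_dim[of i I "\<lambda>_. lborel"] f'] by (simp add: comp_def case_prod_beta)
    then show "(\<lambda>x. \<integral>\<^sup>+y. f (x(i := y)) \<partial>lborel) \<in> borel_measurable (Leb I)"
      by (intro lborel.borel_measurable_nn_integral) (simp add: case_prod_beta)
  qed
  also have "(\<integral>\<^sup>+x. (\<integral>\<^sup>+y. f (x(i := y)) \<partial>lborel) \<partial>Leb I) = (\<integral>\<^sup>+x. f x \<partial>Leb \<Lambda>)"
    unfolding I(3) by (subst product_nn_integral_insert) (use I f' in auto)
  finally show ?thesis .
qed

lemma energy_site_decomposition: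
  assumes fin: "finite \<Lambda>" and i: "i \<in> \<Lambda>"
  shows "energy \<Lambda> b (x(i := z)) = energy (\<Lambda> - {i}) b x + \<psi> i z + 1/2 * M i i * z\<^sup>2
     + (\<Sum>j\<in>\<Lambda> - {i}. M i j * x j) * z + b i * z"
proof -
  define I where "I = \<Lambda> - {i}"
  have I: "finite I" "i \<notin> I" "\<Lambda> = insert i I" using fin i by (auto simp: I_def)
  have upd: "(x(i := z)) j = x j" if "j \<in> I" for j using that I by auto
  have "(\<Sum>k\<in>\<Lambda>. \<Sum>j\<in>\<Lambda>. M k j * (x(i := z)) k * (x(i := z)) j)
    = M i i * z\<^sup>2 + (\<Sum>j\<in>I. M i j * z * x j) + ((\<Sum>k\<in>I. M k i * x k * z) + (\<Sum>k\<in>I. \<Sum>j\<in>I. M k j * x k * x j))"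
    using I upd by (simp add: power2_eq_square mult.assoc sum.distrib cong: sum.cong)
  also have "(\<Sum>k\<in>I. M k i * x k * z) = (\<Sum>j\<in>I. M i j * z * x j)"
    by (simp add: M_symmetric[of _ i] mult_ac)
  also have "(\<Sum>j\<in>I. M i j * z * x j) = (\<Sum>j\<in>I. M i j * x j) * z"
    by (simp add: sum_distrib_left sum_distrib_right mult_ac)
  finally show ?thesis
    unfolding I_def[symmetric] using I upd
    by (simp add: energy_def algebra_simps cong: sum.cong)
qed

text \<open>
The variance is controlled by the mixed covariances, uniformly in the volume and the field. Contract
\<open>x i\<close> by the factor \<open>1/2\<close> towards its mean \<open>m\<close>. The change of variables formula says that the Boltzmann weight
of the contracted configuration has integral twice the partition function, so every upper bound \<open>Q\<close> for
the change of energy satisfies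
\<open>E (1 - Q) \<le> E (exp (- Q)) \<le> 2\<close>. On the other hand convexity of \<open>\<psi>c\<close> shows that the contraction lowers its
contribution up to a term linear in \<open>x i - m\<close>, which has mean zero; \<open>\<psi>b\<close> costs at most \<open>2 * C0\<close>; the diagonal
term gains \<open>3/8 * M i i * (x i - m)\<^sup>2\<close>, and the interaction with the other sites contributes their covariances
with \<open>x i\<close>. Integrating by parts instead would require integrating \<open>\<psi>c'\<close> against the weight, whose growth is
not controlled.
\<close>

lemma variance_bound:
  assumes fin: "finite \<Lambda>" and i: "i \<in> \<Lambda>"
    and k: "\<And>j. j \<in> \<Lambda> - {i} \<Longrightarrow> \<bar>cov (gibbs \<Lambda> b) (\<lambda>x. x i) (\<lambda>x. x j)\<bar> \<le> k j"
  shows "3 / 8 * \<delta> * cov (gibbs \<Lambda> b) (\<lambda>x. x i) (\<lambda>x. x i)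
     \<le> 1 + 2 * C0 + 1/2 * (\<Sum>j\<in>\<Lambda> - {i}. \<bar>M i j\<bar> * k j)"
proof -
  interpret prob_space "gibbs \<Lambda> b" using fin by (rule prob_space_gibbs)
  define m where "m = (LINT x|gibbs \<Lambda> b. x i)"
  define V where "V = cov (gibbs \<Lambda> b) (\<lambda>x. x i) (\<lambda>x. x i)"
  define I where "I = \<Lambda> - {i}"
  define r where "r = deriv (\<psi>c i) m"
  define Q where "Q = (\<lambda>x. 2 * C0 - 3 / 8 * M i i * (x i - m)\<^sup>2
     - 1/2 * ((x i - m) * (r + M i i * m + b i) + (\<Sum>j\<in>I. M i j * ((x i - m) * x j))))"
  have co: "moderate \<Lambda> (\<lambda>x. x j)" if "j \<in> \<Lambda>" for j using fin that by blast
  have IL: "j \<in> \<Lambda>" if "j \<in> I" for j using that by (simp add: I_def)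
  note mod = moderate_mult moderate_add moderate_diff moderate_const moderate_power2 moderate_sum
  have Q: "moderate \<Lambda> Q"
    unfolding Q_def by (intro mod co i IL)
  note int = integrable_gibbs[OF fin, where b = b]

  have pointwise: "energy \<Lambda> b (x(i := (m + x i) / 2)) - energy \<Lambda> b x \<le> Q x" for x
  proof -
    define u where "u = x i - m"
    have xi: "x i = m + u" by (simp add: u_def)
    define h where "h = m + u / 2"
    have half: "(m + x i) / 2 = h" by (simp add: h_def u_def field_simps)
    \<comment> \<open>Convexity bounds the value at the midpoint by the average of the values at the ends, and the tangent at
      \<open>m\<close> then leaves half of the linear term.\<close>
    have "\<psi>c i h \<le> 1/2 * \<psi>c i m + 1/2 * \<psi>c i (x i)"
      using convex_onD[OF psi_c_convex[of i], of "1/2" m "x i"] by (simp add: h_def u_def field_simps)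
    moreover have "\<psi>c i m + r * u \<le> \<psi>c i (x i)"
      using psi_c_tangent[of i m "x i"] by (simp add: r_def u_def)
    ultimately have c: "\<psi>c i h - \<psi>c i (x i) \<le> - 1/2 * (r * u)" by simp
    have bb: "\<psi>b i h - \<psi>b i (x i) \<le> 2 * C0"
      using psi_b_bounded[of i h] psi_b_bounded[of i "x i"] by linarith
    have "energy \<Lambda> b (x(i := h)) - energy \<Lambda> b (x(i := x i)) =
       (\<psi> i h - \<psi> i (x i)) + 1/2 * M i i * (h\<^sup>2 - (x i)\<^sup>2) + ((\<Sum>j\<in>I. M i j * x j) + b i) * (h - x i)"
      unfolding energy_site_decomposition[OF fin i] I_def[symmetric] by (simp add: algebra_simps)
    also have "h - x i = - u / 2" by (simp add: h_def u_def field_simps)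
    also have "h\<^sup>2 - (x i)\<^sup>2 = - m * u - 3/4 * u\<^sup>2"
      unfolding xi h_def by (simp add: power2_eq_square field_simps)
    finally have "energy \<Lambda> b (x(i := h)) - energy \<Lambda> b x
      \<le> 2 * C0 - 1/2 * (r * u) + 1/2 * M i i * (- m * u - 3/4 * u\<^sup>2) + ((\<Sum>j\<in>I. M i j * x j) + b i) * (- u / 2)"
      using c bb psi_split[of i h] psi_split[of i "x i"] by (simp only: fun_upd_triv)
    also have "\<dots> = Q x"
    proof -
      have "(\<Sum>j\<in>I. M i j * (u * x j)) = u * (\<Sum>j\<in>I. M i j * x j)"
        by (simp add: sum_distrib_left mult_ac)
      then show ?thesis unfolding Q_def u_def[symmetric] by (simp add: algebra_simps)
    qed
    finally show ?thesis by (simp add: half)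
  qed

  have meas: "(\<lambda>x. ennreal (boltz \<Lambda> b x)) \<in> borel_measurable (Leb \<Lambda>)" by measurable
  have iQ: "integrable (Leb \<Lambda>) (\<lambda>x. (1 - Q x) * boltz \<Lambda> b x)"
    by (intro integrable_boltz fin mod Q)
  have Qm [measurable]: "Q \<in> borel_measurable (Leb \<Lambda>)" using Q by (rule moderate_measurable)
  have "ennreal (LINT x|Leb \<Lambda>. (1 - Q x) * boltz \<Lambda> b x) \<le> (\<integral>\<^sup>+x. ennreal ((1 - Q x) * boltz \<Lambda> b x) \<partial>Leb \<Lambda>)"
    by (rule integral_le_nn_integral[OF iQ])
  also have "\<dots> \<le> (\<integral>\<^sup>+x. ennreal (boltz \<Lambda> b (x(i := (m + x i) / 2))) \<partial>Leb \<Lambda>)"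
  proof (intro nn_integral_mono ennreal_leI)
    fix x :: "'i \<Rightarrow> real"
    have "(1 - Q x) * boltz \<Lambda> b x \<le> exp (- Q x) * boltz \<Lambda> b x"
      using exp_ge_add_one_self[of "- Q x"] boltz_pos[of \<Lambda> b x] by (intro mult_right_mono) auto
    also have "\<dots> = exp (- Q x - energy \<Lambda> b x)" by (simp add: boltz_def exp_add[symmetric])
    also have "\<dots> \<le> boltz \<Lambda> b (x(i := (m + x i) / 2))"
      unfolding boltz_def using pointwise[of x] by simp
    finally show "(1 - Q x) * boltz \<Lambda> b x \<le> boltz \<Lambda> b (x(i := (m + x i) / 2))" .
  qed
  also have "\<dots> = 2 * (\<integral>\<^sup>+x. ennreal (boltz \<Lambda> b x) \<partial>Leb \<Lambda>)"
    by (rule nn_integral_halve_coordinate[OF fin i meas])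
  also have "(\<integral>\<^sup>+x. ennreal (boltz \<Lambda> b x) \<partial>Leb \<Lambda>) = ennreal (partition_function \<Lambda> b)"
    unfolding partition_function_def using boltz_pos
    by (intro nn_integral_eq_integral integrable_boltz' fin) (auto intro!: AE_I2 intro: less_imp_le)
  also have "2 * ennreal (partition_function \<Lambda> b) = ennreal (2 * partition_function \<Lambda> b)"
    using partition_function_pos[OF fin, of b] by (simp add: ennreal_mult')
  finally have "(LINT x|Leb \<Lambda>. (1 - Q x) * boltz \<Lambda> b x) \<le> 2 * partition_function \<Lambda> b"
    using partition_function_pos[OF fin, of b] by (subst (asm) ennreal_le_iff) auto
  then have "(LINT x|gibbs \<Lambda> b. 1 - Q x) \<le> 2"
    using partition_function_pos[OF fin, of b] by (subst integral_gibbs[OF fin]) (auto intro!: mod Q simp: field_simps)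
  moreover have "(LINT x|gibbs \<Lambda> b. 1 - Q x) = 1 - (LINT x|gibbs \<Lambda> b. Q x)"
    using int[OF Q] fin by (simp add: prob_space)
  ultimately have EQ: "- 1 \<le> (LINT x|gibbs \<Lambda> b. Q x)" by simp

  have "(LINT x|gibbs \<Lambda> b. x i - m) = 0"
    using int[OF co[OF i]] fin by (simp add: m_def prob_space)
  moreover have cv: "(LINT x|gibbs \<Lambda> b. (x i - m) * x j) = cov (gibbs \<Lambda> b) (\<lambda>x. x i) (\<lambda>x. x j)" if "j \<in> \<Lambda>" for j
    using cov_centred[OF fin co[OF i] co[OF that], where c = 0] by (simp add: m_def)
  moreover have "(LINT x|gibbs \<Lambda> b. (x i - m)\<^sup>2) = V"
    unfolding V_def cov_centred[OF fin co[OF i] co[OF i], where c = m] by (simp add: m_def power2_eq_square)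
  moreover have "(LINT x|gibbs \<Lambda> b. Q x) = 2 * C0 - 3 / 8 * M i i * (LINT x|gibbs \<Lambda> b. (x i - m)\<^sup>2)
     - 1/2 * ((LINT x|gibbs \<Lambda> b. x i - m) * (r + M i i * m + b i) + (\<Sum>j\<in>I. M i j * (LINT x|gibbs \<Lambda> b. (x i - m) * x j)))"
  proof -
    have [simp]: "integrable (gibbs \<Lambda> b) (\<lambda>x. (x i - m) * x j)" if "j \<in> I" for j
      by (intro int mod co i IL that)
    have [simp]: "integrable (gibbs \<Lambda> b) (\<lambda>x. (x i - m)\<^sup>2)" "integrable (gibbs \<Lambda> b) (\<lambda>x. x i - m)"
      by (intro int mod co i)+
    have lin: "(LINT x|gibbs \<Lambda> b. a - p * w x - q * (u x * s + v x)) = a - p * (LINT x|gibbs \<Lambda> b. w x)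
        - q * ((LINT x|gibbs \<Lambda> b. u x) * s + (LINT x|gibbs \<Lambda> b. v x))"
      if "integrable (gibbs \<Lambda> b) u" "integrable (gibbs \<Lambda> b) v" "integrable (gibbs \<Lambda> b) w"
      for a p q s :: real and u v w
      using that by (simp add: prob_space)
    have "(LINT x|gibbs \<Lambda> b. (\<Sum>j\<in>I. M i j * ((x i - m) * x j)))
        = (\<Sum>j\<in>I. M i j * (LINT x|gibbs \<Lambda> b. (x i - m) * x j))"
      by (subst Bochner_Integration.integral_sum) auto
    then show ?thesis unfolding Q_def by (subst lin) auto
  qed
  \<comment> \<open>Taking expectations in \<open>Q\<close> removes the linear term and turns the interaction into covariances.\<close>
  ultimately have "3 / 8 * M i i * V \<le> 1 + 2 * C0 - 1/2 * (\<Sum>j\<in>I. M i j * cov (gibbs \<Lambda> b) (\<lambda>x. x i) (\<lambda>x. x j))"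
    using EQ IL by simp
  also have "\<dots> \<le> 1 + 2 * C0 + 1/2 * (\<Sum>j\<in>I. \<bar>M i j\<bar> * k j)"
  proof -
    have "- (\<Sum>j\<in>I. M i j * cov (gibbs \<Lambda> b) (\<lambda>x. x i) (\<lambda>x. x j))
       \<le> (\<Sum>j\<in>I. \<bar>M i j * cov (gibbs \<Lambda> b) (\<lambda>x. x i) (\<lambda>x. x j)\<bar>)"
      using sum_abs[of "\<lambda>j. M i j * cov (gibbs \<Lambda> b) (\<lambda>x. x i) (\<lambda>x. x j)" I] by linarith
    also have "\<dots> \<le> (\<Sum>j\<in>I. \<bar>M i j\<bar> * k j)"
      using k by (intro sum_mono) (auto simp: abs_mult I_def intro!: mult_left_mono)
    finally show ?thesis by simp
  qed
  finally have "3 / 8 * M i i * V \<le> 1 + 2 * C0 + 1/2 * (\<Sum>j\<in>I. \<bar>M i j\<bar> * k j)" .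
  moreover have "0 \<le> V"
    unfolding \<open>(LINT x|gibbs \<Lambda> b. (x i - m)\<^sup>2) = V\<close>[symmetric] by (rule Bochner_Integration.integral_nonneg) simp
  then have "\<delta> * V \<le> M i i * V" using M_diag_ge[of i] by (intro mult_right_mono)
  ultimately show ?thesis by (simp add: V_def I_def)
qed

lemma abs_deviation_le_variance:
  assumes fin: "finite \<Lambda>" and k: "k \<in> \<Lambda>"
  shows "(LINT x|gibbs \<Lambda> b. \<bar>x k - (LINT x|gibbs \<Lambda> b. x k)\<bar>) \<le> 1 + cov (gibbs \<Lambda> b) (\<lambda>x. x k) (\<lambda>x. x k)"
proof -
  interpret prob_space "gibbs \<Lambda> b" using fin by (rule prob_space_gibbs)
  define m where "m = (LINT x|gibbs \<Lambda> b. x k)"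
  have co: "moderate \<Lambda> (\<lambda>x. x k)" using fin k by blast
  note mod = moderate_mult moderate_add moderate_diff moderate_const moderate_power2 moderate_abs co
  note int = integrable_gibbs[OF fin, where b = b]
  have "(LINT x|gibbs \<Lambda> b. \<bar>x k - m\<bar>) \<le> (LINT x|gibbs \<Lambda> b. 1 + (x k * x k - 2 * m * x k + m * m))"
  proof (rule integral_mono)
    fix x :: "'i \<Rightarrow> real"
    \<comment> \<open>This is \<open>\<bar>u\<bar> \<le> 1 + u\<^sup>2\<close>, which avoids square roots of variances.\<close>
    have "0 \<le> (\<bar>x k - m\<bar> - 1/2)\<^sup>2" by simp
    also have "(\<bar>x k - m\<bar> - 1/2)\<^sup>2 = (x k - m)\<^sup>2 - \<bar>x k - m\<bar> + 1/4"
      unfolding power2_diff[of "\<bar>x k - m\<bar>"] by (simp add: power2_eq_square)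
    also have "(x k - m)\<^sup>2 = x k * x k - 2 * m * x k + m * m"
      by (simp add: power2_eq_square algebra_simps)
    finally show "\<bar>x k - m\<bar> \<le> 1 + (x k * x k - 2 * m * x k + m * m)"
      by linarith
  qed (intro int mod)+
  also have "\<dots> = 1 + ((LINT x|gibbs \<Lambda> b. x k * x k) - 2 * m * m + m * m)"
    using int[OF co] int[OF moderate_mult[OF co co]] by (simp add: m_def prob_space)
  also have "\<dots> = 1 + cov (gibbs \<Lambda> b) (\<lambda>x. x k) (\<lambda>x. x k)"
    by (simp add: cov_def m_def)
  finally show ?thesis by (simp add: m_def)
qed

section \<open>Covariances of local functions\<close>

text \<open>
Fixing the coordinates in \<open>A\<close> adds \<open>\<Sum>k\<in>A. M i k * x k\<close> to the field felt by a site \<open>i\<close> of \<open>B\<close>.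
\<close>

lemma energy_merge:
  assumes fin: "finite A" "finite B" and disj: "A \<inter> B = {}"
  shows "energy (A \<union> B) b (merge A B (x, y))
     = energy A b x + energy B (\<lambda>i. b i + (\<Sum>k\<in>A. M i k * x k)) y"
proof -
  have split: "(\<Sum>i\<in>A \<union> B. g i) = (\<Sum>i\<in>A. g i) + (\<Sum>i\<in>B. g i)" for g :: "'i \<Rightarrow> real"
    using fin disj by (rule sum.union_disjoint)
  define X where "X = (\<Sum>i\<in>B. (\<Sum>k\<in>A. M i k * x k) * y i)"
  have BA: "(\<Sum>i\<in>B. \<Sum>j\<in>A. M i j * y i * x j) = X"
    by (simp add: X_def sum_distrib_left sum_distrib_right mult_ac)
  have AB: "(\<Sum>i\<in>A. \<Sum>j\<in>B. M i j * x i * y j) = X"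
    unfolding BA[symmetric] by (subst sum.swap) (simp add: M_symmetric mult_ac)
  have m: "\<And>i. i \<in> A \<Longrightarrow> merge A B (x, y) i = x i" "\<And>i. i \<in> B \<Longrightarrow> merge A B (x, y) i = y i"
    using disj by auto
  have "energy (A \<union> B) b (merge A B (x, y)) = ((\<Sum>i\<in>A. \<psi> i (x i)) + (\<Sum>i\<in>B. \<psi> i (y i)))
     + 1/2 * (((\<Sum>i\<in>A. \<Sum>j\<in>A. M i j * x i * x j) + (\<Sum>i\<in>A. \<Sum>j\<in>B. M i j * x i * y j))
        + ((\<Sum>i\<in>B. \<Sum>j\<in>A. M i j * y i * x j) + (\<Sum>i\<in>B. \<Sum>j\<in>B. M i j * y i * y j)))
     + ((\<Sum>i\<in>A. b i * x i) + (\<Sum>i\<in>B. b i * y i))"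
    unfolding energy_def split sum.distrib using m by (simp cong: sum.cong)
  also have "\<dots> = energy A b x + energy B b y + X"
    unfolding AB BA by (simp add: energy_def algebra_simps)
  also have "\<dots> = energy A b x + energy B (\<lambda>i. b i + (\<Sum>k\<in>A. M i k * x k)) y"
    by (simp add: energy_def X_def algebra_simps sum.distrib)
  finally show ?thesis .
qed

lemma boltz_merge:
  assumes "finite A" "finite B" "A \<inter> B = {}"
  shows "boltz (A \<union> B) b (merge A B (x, y)) = boltz A b x * boltz B (\<lambda>i. b i + (\<Sum>k\<in>A. M i k * x k)) y"
  using energy_merge[OF assms] by (simp add: boltz_def exp_add[symmetric])

lemma abs_deviation_le_1:
  fixes f :: "('i \<Rightarrow> real) \<Rightarrow> real"
  assumes fin: "finite \<Lambda>" and f: "f \<in> borel_measurable (Leb \<Lambda>)" and f01: "\<And>x. 0 \<le> f x" "\<And>x. f x \<le> 1"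
  shows "\<bar>f x - (LINT x|gibbs \<Lambda> b. f x)\<bar> \<le> 1"
proof -
  interpret prob_space "gibbs \<Lambda> b" using fin by (rule prob_space_gibbs)
  have "moderate \<Lambda> f" using f f01 by (intro moderate_bounded[where C = 1]) auto
  then have "integrable (gibbs \<Lambda> b) f" by (rule integrable_gibbs[OF fin])
  then have "0 \<le> (LINT x|gibbs \<Lambda> b. f x)" "(LINT x|gibbs \<Lambda> b. f x) \<le> 1"
    using f01 by (auto intro!: integral_le_const Bochner_Integration.integral_nonneg)
  then show ?thesis using f01[of x] by linarith
qed

text \<open>
The estimate for the sites on which \<open>f\<close> may depend; it does not decay, but these sites are few.
\<close>

lemma cov_bounded_coordinate:
  fixes f :: "('i \<Rightarrow> real) \<Rightarrow> real"
  assumes fin: "finite \<Lambda>" and f: "f \<in> borel_measurable (Leb \<Lambda>)"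
    and f01: "\<And>x. 0 \<le> f x" "\<And>x. f x \<le> 1" and i: "i \<in> \<Lambda>"
  shows "\<bar>cov (gibbs \<Lambda> b) f (\<lambda>x. x i)\<bar> \<le> 1 + cov (gibbs \<Lambda> b) (\<lambda>x. x i) (\<lambda>x. x i)"
proof -
  have mf: "moderate \<Lambda> f" using f f01 by (intro moderate_bounded[where C = 1]) auto
  have co: "moderate \<Lambda> (\<lambda>x. x i)" using fin i by blast
  note mod = moderate_mult moderate_diff moderate_const moderate_abs mf co
  note int = integrable_gibbs[OF fin, where b = b]
  define m c where "m = (LINT x|gibbs \<Lambda> b. x i)" and "c = (LINT x|gibbs \<Lambda> b. f x)"
  have "\<bar>cov (gibbs \<Lambda> b) f (\<lambda>x. x i)\<bar> = \<bar>LINT x|gibbs \<Lambda> b. (f x - c) * (x i - m)\<bar>"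
    unfolding c_def by (subst cov_centred[OF fin mf co, where c = m]) simp
  also have "\<dots> \<le> (LINT x|gibbs \<Lambda> b. \<bar>(f x - c) * (x i - m)\<bar>)" by (rule integral_abs_bound)
  also have "\<dots> \<le> (LINT x|gibbs \<Lambda> b. \<bar>x i - m\<bar>)"
    using abs_deviation_le_1[OF fin f f01]
    by (intro integral_mono int mod) (simp add: abs_mult c_def mult_left_le_one_le)
  also have "\<dots> \<le> 1 + cov (gibbs \<Lambda> b) (\<lambda>x. x i) (\<lambda>x. x i)"
    unfolding m_def by (rule abs_deviation_le_variance[OF fin i])
  finally show ?thesis .
qed

text \<open>
The passage from covariances of coordinates to those of a local function. Given the
coordinates in \<open>A\<close>, the function \<open>f\<close> is constant, so its covariance with \<open>x i\<close> equals its covariance with the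
conditional mean \<open>g x\<close> of \<open>x i\<close>. If \<open>g\<close> is Lipschitz with small constants, then \<open>g\<close> hardly fluctuates and the covariance
is small, whatever the regularity of \<open>f\<close>.
\<close>

lemma cov_bound_by_conditioning:
  fixes f :: "('i \<Rightarrow> real) \<Rightarrow> real"
  assumes fin: "finite A" "finite B" and disj: "A \<inter> B = {}" and i: "i \<in> B"
    and f: "f \<in> borel_measurable (Leb (A \<union> B))" and f01: "\<And>x. 0 \<le> f x" "\<And>x. f x \<le> 1"
    and f_local: "\<And>x y y'. f (merge A B (x, y)) = f (merge A B (x, y'))"
    and l: "\<And>k. k \<in> A \<Longrightarrow> 0 \<le> l k"
    and lip: "\<And>x x'. \<bar>(LINT y|gibbs B (\<lambda>j. b j + (\<Sum>k\<in>A. M j k * x k)). y i)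
         - (LINT y|gibbs B (\<lambda>j. b j + (\<Sum>k\<in>A. M j k * x' k)). y i)\<bar> \<le> (\<Sum>k\<in>A. l k * \<bar>x k - x' k\<bar>)"
    and var: "\<And>k. k \<in> A \<Longrightarrow> cov (gibbs (A \<union> B) b) (\<lambda>x. x k) (\<lambda>x. x k) \<le> K"
  shows "\<bar>cov (gibbs (A \<union> B) b) f (\<lambda>x. x i)\<bar> \<le> (1 + K) * (\<Sum>k\<in>A. l k)"
proof -
  define \<Lambda> where "\<Lambda> = A \<union> B"
  have fin\<Lambda>: "finite \<Lambda>" and i\<Lambda>: "i \<in> \<Lambda>" using fin i by (auto simp: \<Lambda>_def)
  have f': "f \<in> borel_measurable (Leb \<Lambda>)" using f by (simp add: \<Lambda>_def)
  have mf: "moderate \<Lambda> f" using f' f01 by (intro moderate_bounded[where C = 1]) auto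
  have co: "moderate \<Lambda> (\<lambda>x. x j)" if "j \<in> \<Lambda>" for j using fin\<Lambda> that by blast
  have A\<Lambda>: "k \<in> \<Lambda>" if "k \<in> A" for k using that by (simp add: \<Lambda>_def)
  note mod = moderate_mult moderate_diff moderate_const moderate_abs moderate_sum mf co[OF i\<Lambda>] co[OF A\<Lambda>]
  define fld where "fld = (\<lambda>x j. b j + (\<Sum>k\<in>A. M j k * x k))"
  define g where "g = (\<lambda>x. LINT y|gibbs B (fld x). y i)"
  define m where "m = (\<lambda>k. LINT x|gibbs \<Lambda> b. x k)"
  define c where "c = (LINT x|gibbs \<Lambda> b. f x)"
  \<comment> \<open>Since \<open>f - c\<close> has mean zero, any constant may be subtracted from \<open>x i\<close>. The value \<open>g m\<close> of the
    conditional mean at the mean configuration makes \<open>g x - g m\<close> comparable to the deviations \<open>x k - m k\<close>.\<close>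
  define F where "F = (\<lambda>x. (f x - c) * (x i - g m))"
  define G where "G = (\<lambda>x. \<Sum>k\<in>A. l k * \<bar>x k - m k\<bar>)"
  have mF: "moderate \<Lambda> F" and mG: "moderate \<Lambda> G"
    unfolding F_def G_def by (intro mod; assumption)+
  have "\<bar>LINT z|Leb (A \<union> B). F z * boltz (A \<union> B) b z\<bar> \<le> (LINT z|Leb (A \<union> B). G z * boltz (A \<union> B) b z)"
  proof (rule abs_integral_le_by_slices[OF fin disj])
    show "integrable (Leb (A \<union> B)) (\<lambda>z. F z * boltz (A \<union> B) b z)"
      "integrable (Leb (A \<union> B)) (\<lambda>z. G z * boltz (A \<union> B) b z)"
      using integrable_boltz[OF fin\<Lambda> mF, of b] integrable_boltz[OF fin\<Lambda> mG, of b] by (simp_all add: \<Lambda>_def)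
    fix x :: "'i \<Rightarrow> real"
    define fx where "fx = f (merge A B (x, undefined))"
    define Z where "Z = partition_function B (fld x)"
    have Z: "0 < Z" unfolding Z_def by (rule partition_function_pos[OF fin(2)])
    have coB: "moderate B (\<lambda>y. y i)" using fin i by blast
    note intB = integrable_boltz[OF fin(2), where b = "fld x"]
    have merge_i: "merge A B (x, y) i = y i" for y using disj i by simp
    have fx: "f (merge A B (x, y)) = fx" for y unfolding fx_def by (rule f_local)
    have bm: "boltz (A \<union> B) b (merge A B (x, y)) = boltz A b x * boltz B (fld x) y" for y
      by (simp add: boltz_merge[OF fin disj] fld_def)
    have "(LINT y|Leb B. F (merge A B (x, y)) * boltz (A \<union> B) b (merge A B (x, y)))
        = (LINT y|Leb B. ((fx - c) * boltz A b x) * (y i * boltz B (fld x) y - g m * boltz B (fld x) y))"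
      unfolding bm F_def fx merge_i
      by (intro Bochner_Integration.integral_cong refl) (simp add: algebra_simps)
    also have "\<dots> = ((fx - c) * boltz A b x) * ((LINT y|Leb B. y i * boltz B (fld x) y) - g m * Z)"
      using intB[OF coB] integrable_boltz'[OF fin(2), of "fld x"] by (simp add: Z_def partition_function_def)
    also have "(LINT y|Leb B. y i * boltz B (fld x) y) = g x * Z"
      using Z unfolding g_def by (subst integral_gibbs[OF fin(2) coB]) (simp add: Z_def)
    finally have "\<bar>LINT y|Leb B. F (merge A B (x, y)) * boltz (A \<union> B) b (merge A B (x, y))\<bar>
        = \<bar>fx - c\<bar> * (\<bar>g x - g m\<bar> * (boltz A b x * Z))"
      using Z boltz_pos[of A b x] by (simp add: left_diff_distrib[symmetric] abs_mult)
    also have "\<dots> \<le> 1 * ((\<Sum>k\<in>A. l k * \<bar>x k - m k\<bar>) * (boltz A b x * Z))"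
    proof (intro mult_mono)
      show "\<bar>fx - c\<bar> \<le> 1"
        unfolding fx_def c_def by (rule abs_deviation_le_1[OF fin\<Lambda> f' f01])
      show "\<bar>g x - g m\<bar> \<le> (\<Sum>k\<in>A. l k * \<bar>x k - m k\<bar>)"
        unfolding g_def fld_def by (rule lip)
    qed (use Z boltz_pos[of A b x] l in \<open>auto intro!: sum_nonneg\<close>)
    also have "\<dots> = (LINT y|Leb B. ((\<Sum>k\<in>A. l k * \<bar>x k - m k\<bar>) * boltz A b x) * boltz B (fld x) y)"
      by (simp add: Z_def partition_function_def mult.assoc)
    also have "\<dots> = (LINT y|Leb B. G (merge A B (x, y)) * boltz (A \<union> B) b (merge A B (x, y)))"
      unfolding bm G_def using disj
      by (intro Bochner_Integration.integral_cong refl) (simp add: mult.assoc cong: sum.cong)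
    finally show "\<bar>LINT y|Leb B. F (merge A B (x, y)) * boltz (A \<union> B) b (merge A B (x, y))\<bar>
        \<le> (LINT y|Leb B. G (merge A B (x, y)) * boltz (A \<union> B) b (merge A B (x, y)))" .
  qed
  then have "\<bar>LINT x|gibbs \<Lambda> b. F x\<bar> \<le> (LINT x|gibbs \<Lambda> b. G x)"
    unfolding integral_gibbs[OF fin\<Lambda> mF] integral_gibbs[OF fin\<Lambda> mG] using partition_function_pos[OF fin\<Lambda>, of b]
    by (simp add: \<Lambda>_def divide_right_mono)
  also have "(LINT x|gibbs \<Lambda> b. G x) = (\<Sum>k\<in>A. l k * (LINT x|gibbs \<Lambda> b. \<bar>x k - m k\<bar>))"
    unfolding G_def
    by (subst Bochner_Integration.integral_sum) (auto intro!: integrable_gibbs[OF fin\<Lambda>] mod)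
  also have "\<dots> \<le> (\<Sum>k\<in>A. l k * (1 + K))"
  proof (intro sum_mono mult_left_mono)
    fix k assume k: "k \<in> A"
    show "(LINT x|gibbs \<Lambda> b. \<bar>x k - m k\<bar>) \<le> 1 + K"
      using abs_deviation_le_variance[OF fin\<Lambda> A\<Lambda>[OF k], of b] var[OF k] by (simp add: \<Lambda>_def m_def)
  qed (use l in auto)
  finally show ?thesis
    unfolding \<Lambda>_def[symmetric] cov_centred[OF fin\<Lambda> mf co[OF i\<Lambda>], where c = "g m"]
    by (simp add: F_def c_def sum_distrib_right[symmetric] mult.commute)
qed

end

section \<open>Decaying interactions and covariances\<close>

text \<open>
Both decay hypotheses are expressed through one symmetric kernel \<open>w\<close> with bounded row sums. The
diagonal is normalised to be at least \<open>1\<close> so that the variances, too, can be absorbed in the kernel.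
\<close>

locale decaying_spin_system = spin_energy \<psi> \<psi>c \<psi>b M \<delta> C0
  for \<psi> \<psi>c \<psi>b :: "int ^ 'd \<Rightarrow> real \<Rightarrow> real" and M :: "int ^ 'd \<Rightarrow> int ^ 'd \<Rightarrow> real" and \<delta> C0 :: real +
  fixes w :: "int ^ 'd \<Rightarrow> int ^ 'd \<Rightarrow> real" and S C1 C2 :: real
  assumes w_nonneg: "\<And>i j. 0 \<le> w i j"
    and w_diag: "\<And>i. 1 \<le> w i i"
    and w_symmetric: "\<And>i j. w i j = w j i"
    and w_sum: "\<And>F i. finite F \<Longrightarrow> (\<Sum>j\<in>F. w i j) \<le> S"
    and C1_nonneg: "0 \<le> C1" and C2_nonneg: "0 \<le> C2"
    and M_decay: "\<And>i j. i \<noteq> j \<Longrightarrow> \<bar>M i j\<bar> \<le> C1 * w i j"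
    and cov_decay: "\<And>\<Lambda> \<omega> i j. finite \<Lambda> \<Longrightarrow> tempered M \<Lambda> \<omega> \<Longrightarrow> i \<in> \<Lambda> \<Longrightarrow> j \<in> \<Lambda> \<Longrightarrow> i \<noteq> j \<Longrightarrow>
           \<bar>cov (finite_volume_gibbs \<psi> M \<Lambda> \<omega>) (\<lambda>x. x i) (\<lambda>x. x j)\<bar> \<le> C2 * w i j"
begin

lemma w_summable: "w i summable_on UNIV"
  by (rule nonneg_bdd_above_summable_on) (auto simp: w_nonneg w_sum intro!: bdd_aboveI[where M = S])

lemma w_le_S: "w i j \<le> S"
  using w_sum[of "{j}" i] by simp

lemma S_ge_1: "1 \<le> S"
  using w_le_S[of undefined undefined] w_diag[of undefined] by linarith

lemma M_summable: "(\<lambda>j. \<bar>M i j\<bar>) summable_on - {i}"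
proof (rule nonneg_bdd_above_summable_on)
  have "(\<Sum>j\<in>F. \<bar>M i j\<bar>) \<le> C1 * S" if F: "F \<subseteq> - {i}" "finite F" for F
  proof -
    have "(\<Sum>j\<in>F. \<bar>M i j\<bar>) \<le> (\<Sum>j\<in>F. C1 * w i j)" using F by (intro sum_mono M_decay) auto
    also have "\<dots> \<le> C1 * S" unfolding sum_distrib_left[symmetric]
      using C1_nonneg w_sum[OF F(2)] by (intro mult_left_mono)
    finally show ?thesis .
  qed
  then show "bdd_above (sum (\<lambda>j. \<bar>M i j\<bar>) ` {F. F \<subseteq> - {i} \<and> finite F})"
    by (intro bdd_aboveI[where M = "C1 * S"]) auto
qed auto

lemma M_sum_le:
  assumes "i \<notin> A" shows "(\<Sum>\<^sub>\<infinity>j\<in>A. \<bar>M i j\<bar>) \<le> C1 * S"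
proof (rule infsum_le_finite_sums)
  show "(\<lambda>j. \<bar>M i j\<bar>) summable_on A"
    using summable_on_subset_banach[OF M_summable[of i]] assms by auto
  fix F assume F: "finite F" "F \<subseteq> A"
  have "(\<Sum>j\<in>F. \<bar>M i j\<bar>) \<le> (\<Sum>j\<in>F. C1 * w i j)" using F assms by (intro sum_mono M_decay) auto
  also have "\<dots> \<le> C1 * S" unfolding sum_distrib_left[symmetric]
    using C1_nonneg w_sum[OF F(1)] by (intro mult_left_mono)
  finally show "(\<Sum>j\<in>F. \<bar>M i j\<bar>) \<le> C1 * S" .
qed

definition boundary_field :: "(int ^ 'd) set \<Rightarrow> 'd config \<Rightarrow> int ^ 'd \<Rightarrow> real" where
  "boundary_field \<Lambda> \<omega> i = (\<Sum>\<^sub>\<infinity>j\<in>- \<Lambda>. M i j * \<omega> j)"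

lemma finite_volume_gibbs_eq: "finite_volume_gibbs \<psi> M \<Lambda> \<omega> = gibbs \<Lambda> (boundary_field \<Lambda> \<omega>)"
proof -
  have "(\<Sum>\<^sub>\<infinity>j\<in>- \<Lambda>. M i j * x i * \<omega> j) = boundary_field \<Lambda> \<omega> i * x i" for x :: "'d config" and i
    unfolding boundary_field_def infsum_cmult_left'[symmetric] by (simp add: mult_ac)
  then have "hamiltonian \<psi> M \<Lambda> \<omega> x = energy \<Lambda> (boundary_field \<Lambda> \<omega>) x" for x
    by (simp add: hamiltonian_def energy_def)
  then show ?thesis
    by (simp add: finite_volume_gibbs_def gibbs_def boltz_def partition_function_def Let_def)
qed

lemma tempered_summable:
  assumes "tempered M \<Lambda> \<omega>" "i \<in> \<Lambda>"
  shows "(\<lambda>j. M i j * \<omega> j) summable_on - \<Lambda>"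
proof (rule abs_summable_summable)
  show "(\<lambda>j. norm (M i j * \<omega> j)) summable_on - \<Lambda>"
    using assms by (simp add: tempered_def abs_mult)
qed

lemma tempered_scale: "tempered M \<Lambda> \<omega> \<Longrightarrow> tempered M \<Lambda> (\<lambda>j. t * \<omega> j)"
  unfolding tempered_def
  using summable_on_cmult_right[of "\<lambda>j. \<bar>M _ j\<bar> * \<bar>\<omega> j\<bar>" "- \<Lambda>" "\<bar>t\<bar>"] by (simp add: abs_mult mult_ac)

lemma boundary_field_scale: "boundary_field \<Lambda> (\<lambda>j. t * \<omega> j) i = t * boundary_field \<Lambda> \<omega> i"
  unfolding boundary_field_def infsum_cmult_right'[symmetric] by (simp add: mult_ac)

text \<open>
Conditioning a finite-volume measure on the coordinates in \<open>A\<close> yields the finite-volume measure on \<open>B\<close> whose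
boundary values are \<open>x\<close> on \<open>A\<close> and \<open>\<omega>\<close> elsewhere. These are again tempered, because only finitely many
values have been added; hence the covariance hypothesis applies to the conditional measures as well.
\<close>

lemma
  assumes fin: "finite A" and disj: "A \<inter> B = {}" and temp: "tempered M (A \<union> B) \<omega>"
  defines "\<omega>' \<equiv> \<lambda>x j. if j \<in> A then x j else \<omega> j"
  shows tempered_fill: "tempered M B (\<omega>' x)"
    and boundary_field_fill: "j \<in> B \<Longrightarrow> boundary_field B (\<omega>' x) j = boundary_field (A \<union> B) \<omega> j + (\<Sum>k\<in>A. M j k * x k)"
proof -
  have cB: "- B = - (A \<union> B) \<union> A" and d: "- (A \<union> B) \<inter> A = {}" using disj by auto
  show "tempered M B (\<omega>' x)"
    unfolding tempered_def cB
  proof (intro ballI summable_on_Un_disjoint d)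
    fix i assume "i \<in> B"
    then have "(\<lambda>j. \<bar>M i j\<bar> * \<bar>\<omega> j\<bar>) summable_on - (A \<union> B)" using temp by (auto simp: tempered_def)
    then show "(\<lambda>j. \<bar>M i j\<bar> * \<bar>\<omega>' x j\<bar>) summable_on - (A \<union> B)"
      by (rule summable_on_cong[THEN iffD1, rotated]) (auto simp: \<omega>'_def)
  qed (use fin in auto)
  assume j: "j \<in> B"
  have eq: "(\<Sum>\<^sub>\<infinity>k\<in>- (A \<union> B). M j k * \<omega>' x k) = boundary_field (A \<union> B) \<omega> j"
    unfolding boundary_field_def by (intro infsum_cong) (auto simp: \<omega>'_def)
  have "boundary_field B (\<omega>' x) j = (\<Sum>\<^sub>\<infinity>k\<in>- (A \<union> B). M j k * \<omega>' x k) + (\<Sum>\<^sub>\<infinity>k\<in>A. M j k * \<omega>' x k)"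
    unfolding boundary_field_def cB
  proof (intro infsum_Un_disjoint d)
    show "(\<lambda>k. M j k * \<omega>' x k) summable_on - (A \<union> B)"
      using tempered_summable[OF temp, of j] j
      by (subst summable_on_cong[where g = "\<lambda>k. M j k * \<omega> k"]) (auto simp: \<omega>'_def)
  qed (use fin in auto)
  then show "boundary_field B (\<omega>' x) j = boundary_field (A \<union> B) \<omega> j + (\<Sum>k\<in>A. M j k * x k)"
    unfolding eq using fin by (simp add: \<omega>'_def)
qed

text \<open>
The bound that \<open>variance_bound\<close> yields when the mixed covariances are inserted, with
\<open>\<Sum>j\<noteq>i. \<bar>M i j\<bar> * C2 * w i j \<le> C1 * C2 * S\<^sup>2\<close>.
\<close>

definition Vmax :: real where
  "Vmax = 8 / (3 * \<delta>) * (1 + 2 * C0 + 1/2 * (C1 * C2 * S\<^sup>2))"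

lemma Vmax_nonneg: "0 \<le> Vmax"
  using delta_pos C0_nonneg C1_nonneg C2_nonneg by (simp add: Vmax_def)

lemma variance_le_Vmax:
  assumes fin: "finite \<Lambda>" and temp: "tempered M \<Lambda> \<omega>" and i: "i \<in> \<Lambda>"
  shows "cov (gibbs \<Lambda> (boundary_field \<Lambda> \<omega>)) (\<lambda>x. x i) (\<lambda>x. x i) \<le> Vmax"
proof -
  have "3 / 8 * \<delta> * cov (gibbs \<Lambda> (boundary_field \<Lambda> \<omega>)) (\<lambda>x. x i) (\<lambda>x. x i)
     \<le> 1 + 2 * C0 + 1/2 * (\<Sum>j\<in>\<Lambda> - {i}. \<bar>M i j\<bar> * (C2 * w i j))"
    using cov_decay[OF fin temp i] by (intro variance_bound[OF fin i]) (auto simp: finite_volume_gibbs_eq)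
  also have "(\<Sum>j\<in>\<Lambda> - {i}. \<bar>M i j\<bar> * (C2 * w i j)) \<le> (\<Sum>j\<in>\<Lambda> - {i}. (C1 * w i j) * (C2 * S))"
    using M_decay[of i] w_nonneg C1_nonneg C2_nonneg w_le_S
    by (intro sum_mono mult_mono mult_left_mono mult_nonneg_nonneg) auto
  also have "\<dots> = C1 * C2 * S * (\<Sum>j\<in>\<Lambda> - {i}. w i j)"
    by (simp add: sum_distrib_left mult_ac)
  also have "\<dots> \<le> C1 * C2 * S * S"
    using C1_nonneg C2_nonneg S_ge_1 w_sum[of "\<Lambda> - {i}" i] fin by (intro mult_left_mono) auto
  finally show ?thesis
    using delta_pos by (simp add: Vmax_def field_simps power2_eq_square)
qed

definition Cmax :: real where "Cmax = C2 + Vmax"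

lemma Cmax_nonneg: "0 \<le> Cmax"
  using C2_nonneg Vmax_nonneg by (simp add: Cmax_def)

lemma abs_cov_le:
  assumes fin: "finite \<Lambda>" and temp: "tempered M \<Lambda> \<omega>" and i: "i \<in> \<Lambda>" and j: "j \<in> \<Lambda>"
  shows "\<bar>cov (gibbs \<Lambda> (boundary_field \<Lambda> \<omega>)) (\<lambda>x. x i) (\<lambda>x. x j)\<bar> \<le> Cmax * w i j"
proof (cases "i = j")
  case True
  have "0 \<le> cov (gibbs \<Lambda> (boundary_field \<Lambda> \<omega>)) (\<lambda>x. x i) (\<lambda>x. x i)"
    using fin i by (subst cov_centred[where c = "LINT x|gibbs \<Lambda> (boundary_field \<Lambda> \<omega>). x i"]) auto
  then have "\<bar>cov (gibbs \<Lambda> (boundary_field \<Lambda> \<omega>)) (\<lambda>x. x i) (\<lambda>x. x j)\<bar> \<le> Cmax * 1"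
    using variance_le_Vmax[OF fin temp i] True C2_nonneg by (simp add: Cmax_def)
  also have "\<dots> \<le> Cmax * w i j" using True w_diag[of i] Cmax_nonneg by (intro mult_left_mono) auto
  finally show ?thesis .
next
  case False
  have "\<bar>cov (gibbs \<Lambda> (boundary_field \<Lambda> \<omega>)) (\<lambda>x. x i) (\<lambda>x. x j)\<bar> \<le> C2 * w i j"
    using cov_decay[OF fin temp i j False] by (simp add: finite_volume_gibbs_eq)
  also have "\<dots> \<le> Cmax * w i j" using w_nonneg Vmax_nonneg by (intro mult_right_mono) (auto simp: Cmax_def)
  finally show ?thesis .
qed

text \<open>
The convolution of the kernel with itself: influence transmitted from \<open>k\<close> through an intermediate site to \<open>i\<close>.
\<close>

definition w_conv :: "int ^ 'd \<Rightarrow> int ^ 'd \<Rightarrow> real" where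
  "w_conv i k = (\<Sum>\<^sub>\<infinity>j. w i j * w j k)"

lemma w_conv_summand: "(\<lambda>j. w i j * w j k) summable_on UNIV"
proof (rule summable_on_comparison_test)
  show "(\<lambda>j. S * w k j) summable_on UNIV" by (intro summable_on_cmult_right w_summable)
  show "w i j * w j k \<le> S * w k j" for j
    using w_le_S w_nonneg by (simp add: w_symmetric[of k] mult_right_mono)
qed (simp add: w_nonneg)

lemma w_conv_nonneg: "0 \<le> w_conv i k"
  unfolding w_conv_def by (rule infsum_nonneg) (simp add: w_nonneg)

lemma sum_le_w_conv: "finite B \<Longrightarrow> (\<Sum>j\<in>B. w i j * w j k) \<le> w_conv i k"
  unfolding w_conv_def by (rule finite_sum_le_infsum[OF w_conv_summand]) (auto simp: w_nonneg)

lemma sum_w_conv_le: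
  assumes F: "finite F" shows "(\<Sum>i\<in>F. w_conv i k) \<le> S * S"
proof -
  have hs: "((\<lambda>j. \<Sum>i\<in>F. w i j * w j k) has_sum (\<Sum>i\<in>F. w_conv i k)) UNIV"
    unfolding w_conv_def by (intro has_sum_finite_sum F has_sum_infsum w_conv_summand)
  then have "(\<Sum>i\<in>F. w_conv i k) = (\<Sum>\<^sub>\<infinity>j. \<Sum>i\<in>F. w i j * w j k)"
    by (rule infsumI[symmetric])
  also have "\<dots> \<le> S * S"
  proof (rule infsum_le_finite_sums)
    show "(\<lambda>j. \<Sum>i\<in>F. w i j * w j k) summable_on UNIV"
      using hs by (rule has_sum_imp_summable)
    fix G :: "(int ^ 'd) set" assume G: "finite G"
    have "(\<Sum>j\<in>G. \<Sum>i\<in>F. w i j * w j k) \<le> (\<Sum>j\<in>G. S * w k j)"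
    proof (rule sum_mono)
      fix j
      have "(\<Sum>i\<in>F. w i j * w j k) = (\<Sum>i\<in>F. w j i) * w k j"
        by (simp add: sum_distrib_right w_symmetric[of _ j])
      also have "\<dots> \<le> S * w k j" using w_sum[OF F, of j] w_nonneg by (intro mult_right_mono)
      finally show "(\<Sum>i\<in>F. w i j * w j k) \<le> S * w k j" .
    qed
    also have "\<dots> \<le> S * S" unfolding sum_distrib_left[symmetric]
      using w_sum[OF G, of k] S_ge_1 by (intro mult_left_mono) auto
    finally show "(\<Sum>j\<in>G. \<Sum>i\<in>F. w i j * w j k) \<le> S * S" .
  qed
  finally show ?thesis .
qed

text \<open>
Moving the condition on \<open>A\<close> from \<open>x'\<close> to \<open>x\<close> changes the field at \<open>j\<close> by \<open>\<Sum>k\<in>A. M j k * (x k - x' k)\<close>, and a field at \<open>j\<close>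
moves the mean of \<open>x i\<close> at the rate of their covariance. Every field on the segment between the two comes from
tempered boundary values, namely those given by the convex combination of \<open>x\<close> and \<open>x'\<close>.
\<close>

lemma conditional_mean_lipschitz:
  assumes fin: "finite A" "finite B" and disj: "A \<inter> B = {}" and i: "i \<in> B"
    and temp: "tempered M (A \<union> B) \<omega>"
  defines "fld \<equiv> \<lambda>x j. boundary_field (A \<union> B) \<omega> j + (\<Sum>k\<in>A. M j k * x k)"
  shows "\<bar>(LINT y|gibbs B (fld x). y i) - (LINT y|gibbs B (fld x'). y i)\<bar>
     \<le> (\<Sum>k\<in>A. Cmax * C1 * w_conv i k * \<bar>x k - x' k\<bar>)"
proof -
  have gibbs_cong: "gibbs B b = gibbs B b'" if "\<And>j. j \<in> B \<Longrightarrow> b j = b' j" for b b'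
  proof -
    have "energy B b = energy B b'" using that by (auto simp: energy_def fun_eq_iff cong: sum.cong)
    then show ?thesis by (simp add: gibbs_def partition_function_def boltz_def)
  qed
  have "\<bar>(LINT y|gibbs B (fld x). y i) - (LINT y|gibbs B (fld x'). y i)\<bar>
     \<le> (\<Sum>j\<in>B. (Cmax * w i j) * \<bar>fld x j - fld x' j\<bar>)"
  proof (rule gibbs_field_comparison[OF fin(2)])
    show "moderate B (\<lambda>y. y i)" using fin i by blast
    fix t :: real and j assume j: "j \<in> B"
    define z where "z = (\<lambda>k. x' k + t * (x k - x' k))"
    define \<eta> where "\<eta> = (\<lambda>j. if j \<in> A then z j else \<omega> j)"
    have "gibbs B (\<lambda>i. fld x' i + t * (fld x i - fld x' i)) = gibbs B (boundary_field B \<eta>)"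
    proof (rule gibbs_cong)
      fix j assume "j \<in> B"
      from boundary_field_fill[OF fin(1) disj temp this, of z]
      show "fld x' j + t * (fld x j - fld x' j) = boundary_field B \<eta> j"
        by (simp add: \<eta>_def fld_def z_def algebra_simps sum.distrib sum_subtractf sum_distrib_left)
    qed
    moreover have "tempered M B \<eta>"
      unfolding \<eta>_def by (rule tempered_fill[OF fin(1) disj temp])
    ultimately show "\<bar>cov (gibbs B (\<lambda>i. fld x' i + t * (fld x i - fld x' i))) (\<lambda>y. y i) (\<lambda>y. y j)\<bar> \<le> Cmax * w i j"
      using abs_cov_le[OF fin(2) _ i j] by simp
  qed
  also have "\<dots> \<le> (\<Sum>j\<in>B. \<Sum>k\<in>A. (Cmax * w i j) * (C1 * w j k * \<bar>x k - x' k\<bar>))"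
  proof (intro sum_mono)
    fix j assume j: "j \<in> B"
    have "fld x j - fld x' j = (\<Sum>k\<in>A. M j k * (x k - x' k))"
      by (simp add: fld_def algebra_simps sum_subtractf)
    then have "\<bar>fld x j - fld x' j\<bar> \<le> (\<Sum>k\<in>A. \<bar>M j k * (x k - x' k)\<bar>)"
      by (simp only: sum_abs)
    also have "\<dots> \<le> (\<Sum>k\<in>A. C1 * w j k * \<bar>x k - x' k\<bar>)"
      using disj j by (intro sum_mono) (auto simp: abs_mult intro!: mult_right_mono M_decay)
    finally show "(Cmax * w i j) * \<bar>fld x j - fld x' j\<bar> \<le> (\<Sum>k\<in>A. (Cmax * w i j) * (C1 * w j k * \<bar>x k - x' k\<bar>))"
      unfolding sum_distrib_left[symmetric] using Cmax_nonneg w_nonneg by (intro mult_left_mono) auto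
  qed
  also have "\<dots> = (\<Sum>k\<in>A. (Cmax * C1 * \<bar>x k - x' k\<bar>) * (\<Sum>j\<in>B. w i j * w j k))"
    by (subst sum.swap) (simp add: sum_distrib_left mult_ac)
  also have "\<dots> \<le> (\<Sum>k\<in>A. (Cmax * C1 * \<bar>x k - x' k\<bar>) * w_conv i k)"
    using Cmax_nonneg C1_nonneg by (intro sum_mono mult_left_mono sum_le_w_conv fin) auto
  finally show ?thesis by (simp add: mult_ac)
qed

section \<open>Sensitivity to boundary values\<close>

text \<open>
A bound, independent of the volume and the boundary values, for the covariance of \<open>x i\<close> with a function that
depends on the coordinates in \<open>A\<close> and takes values in the unit interval.
\<close>

definition influence :: "(int ^ 'd) set \<Rightarrow> int ^ 'd \<Rightarrow> real" where
  "influence A i = (1 + Vmax) * (indicator A i + (\<Sum>k\<in>A. Cmax * C1 * w_conv i k))"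

lemma influence_nonneg: "0 \<le> influence A i"
  unfolding influence_def using Vmax_nonneg Cmax_nonneg C1_nonneg w_conv_nonneg
  by (auto intro!: mult_nonneg_nonneg add_nonneg_nonneg sum_nonneg)

lemma influence_summable:
  assumes A: "finite A" shows "influence A summable_on UNIV"
proof (rule nonneg_bdd_above_summable_on)
  have "sum (influence A) F \<le> (1 + Vmax) * (card A + Cmax * C1 * (card A * (S * S)))" if F: "finite F" for F
  proof -
    \<comment> \<open>The sites of \<open>A\<close> contribute at most \<open>card A\<close>, and each \<open>k\<close> in \<open>A\<close> contributes the total mass of the
      convolved kernel, at most \<open>S\<^sup>2\<close>.\<close>
    have ind: "(\<Sum>i\<in>F. indicator A i :: real) = card (A \<inter> F)"
      using F by (simp add: indicator_def sum.If_cases Int_commute)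
    have "sum (influence A) F = (1 + Vmax) * ((\<Sum>i\<in>F. indicator A i) + (\<Sum>i\<in>F. \<Sum>k\<in>A. Cmax * C1 * w_conv i k))"
      by (simp add: influence_def[abs_def] sum_distrib_left[symmetric] sum.distrib)
    also have "(\<Sum>i\<in>F. \<Sum>k\<in>A. Cmax * C1 * w_conv i k) = Cmax * C1 * (\<Sum>k\<in>A. \<Sum>i\<in>F. w_conv i k)"
      by (subst sum.swap) (simp add: sum_distrib_left)
    finally have "sum (influence A) F = (1 + Vmax) * (card (A \<inter> F) + Cmax * C1 * (\<Sum>k\<in>A. \<Sum>i\<in>F. w_conv i k))"
      unfolding ind .
    also have "\<dots> \<le> (1 + Vmax) * (card A + Cmax * C1 * (card A * (S * S)))"
    proof (intro mult_left_mono add_mono)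
      show "(\<Sum>k\<in>A. \<Sum>i\<in>F. w_conv i k) \<le> card A * (S * S)"
        using sum_bounded_above[of A "\<lambda>k. \<Sum>i\<in>F. w_conv i k" "S * S"] sum_w_conv_le[OF F] by simp
    qed (use Vmax_nonneg Cmax_nonneg C1_nonneg A in \<open>auto simp: card_mono\<close>)
    finally show ?thesis .
  qed
  then show "bdd_above (sum (influence A) ` {F. F \<subseteq> UNIV \<and> finite F})"
    by (intro bdd_aboveI) auto
qed (rule influence_nonneg)

lemma local_cov_le_influence:
  fixes f :: "'d config \<Rightarrow> real"
  assumes fin: "finite \<Lambda>" and A: "A \<subseteq> \<Lambda>" and i: "i \<in> \<Lambda>" and temp: "tempered M \<Lambda> \<omega>"
    and f: "f \<in> borel_measurable (Leb \<Lambda>)" and f01: "\<And>x. 0 \<le> f x" "\<And>x. f x \<le> 1"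
    and f_local: "\<And>x y. (\<And>k. k \<in> A \<Longrightarrow> x k = y k) \<Longrightarrow> f x = f y"
  shows "\<bar>cov (gibbs \<Lambda> (boundary_field \<Lambda> \<omega>)) f (\<lambda>x. x i)\<bar> \<le> influence A i"
proof (cases "i \<in> A")
  case True
  have "\<bar>cov (gibbs \<Lambda> (boundary_field \<Lambda> \<omega>)) f (\<lambda>x. x i)\<bar> \<le> (1 + Vmax) * 1"
    using cov_bounded_coordinate[OF fin f f01 i, of "boundary_field \<Lambda> \<omega>"] variance_le_Vmax[OF fin temp i] by simp
  also have "\<dots> \<le> influence A i"
    unfolding influence_def using True Vmax_nonneg Cmax_nonneg C1_nonneg w_conv_nonneg
    by (intro mult_left_mono) (auto intro!: sum_nonneg mult_nonneg_nonneg)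
  finally show ?thesis .
next
  case False
  define B where "B = \<Lambda> - A"
  have AB: "finite A" "finite B" "A \<inter> B = {}" "\<Lambda> = A \<union> B" "i \<in> B"
    using fin A i False by (auto simp: B_def intro: finite_subset)
  have "\<bar>cov (gibbs (A \<union> B) (boundary_field \<Lambda> \<omega>)) f (\<lambda>x. x i)\<bar> \<le> (1 + Vmax) * (\<Sum>k\<in>A. Cmax * C1 * w_conv i k)"
  proof (rule cov_bound_by_conditioning[OF AB(1,2,3,5) _ f01])
    show "f \<in> borel_measurable (Leb (A \<union> B))" using f AB by simp
    show "f (merge A B (x, y)) = f (merge A B (x, y'))" for x y y'
      using AB by (intro f_local) auto
    show "\<bar>(LINT y|gibbs B (\<lambda>j. boundary_field \<Lambda> \<omega> j + (\<Sum>k\<in>A. M j k * x k)). y i)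
         - (LINT y|gibbs B (\<lambda>j. boundary_field \<Lambda> \<omega> j + (\<Sum>k\<in>A. M j k * x' k)). y i)\<bar>
         \<le> (\<Sum>k\<in>A. Cmax * C1 * w_conv i k * \<bar>x k - x' k\<bar>)" for x x'
      using conditional_mean_lipschitz[OF AB(1,2,3,5), of \<omega> x x'] temp unfolding AB(4) by simp
    show "cov (gibbs (A \<union> B) (boundary_field \<Lambda> \<omega>)) (\<lambda>x. x k) (\<lambda>x. x k) \<le> Vmax" if "k \<in> A" for k
      using variance_le_Vmax[OF fin temp, of k] that unfolding AB(4) by simp
  qed (use Cmax_nonneg C1_nonneg w_conv_nonneg in auto)
  then show ?thesis
    using False by (simp add: influence_def AB(4)[symmetric])
qed

text \<open>
The boundary values are scaled from \<open>0\<close> to \<open>\<omega>\<close>; the scaled ones remain tempered, and their field is the scaled field.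
\<close>

lemma finite_volume_boundary_sensitivity:
  fixes f :: "'d config \<Rightarrow> real"
  assumes fin: "finite \<Lambda>" and A: "A \<subseteq> \<Lambda>" and temp: "tempered M \<Lambda> \<omega>"
    and f: "f \<in> borel_measurable (Leb \<Lambda>)" and f01: "\<And>x. 0 \<le> f x" "\<And>x. f x \<le> 1"
    and f_local: "\<And>x y. (\<And>k. k \<in> A \<Longrightarrow> x k = y k) \<Longrightarrow> f x = f y"
  shows "\<bar>(LINT x|finite_volume_gibbs \<psi> M \<Lambda> \<omega>. f x) - (LINT x|finite_volume_gibbs \<psi> M \<Lambda> (\<lambda>_. 0). f x)\<bar>
     \<le> (\<Sum>i\<in>\<Lambda>. influence A i * (\<Sum>\<^sub>\<infinity>j\<in>- \<Lambda>. \<bar>M i j\<bar> * \<bar>\<omega> j\<bar>))"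
proof -
  have zero: "boundary_field \<Lambda> (\<lambda>_. 0) i = 0" for i by (simp add: boundary_field_def)
  have mf: "moderate \<Lambda> f" using f f01 by (intro moderate_bounded[where C = 1]) auto
  have "\<bar>(LINT x|gibbs \<Lambda> (boundary_field \<Lambda> \<omega>). f x) - (LINT x|gibbs \<Lambda> (boundary_field \<Lambda> (\<lambda>_. 0)). f x)\<bar>
     \<le> (\<Sum>i\<in>\<Lambda>. influence A i * \<bar>boundary_field \<Lambda> \<omega> i - boundary_field \<Lambda> (\<lambda>_. 0) i\<bar>)"
  proof (rule gibbs_field_comparison[OF fin mf])
    fix t :: real and j assume j: "j \<in> \<Lambda>"
    have "(\<lambda>i. boundary_field \<Lambda> (\<lambda>_. 0) i + t * (boundary_field \<Lambda> \<omega> i - boundary_field \<Lambda> (\<lambda>_. 0) i)) = boundary_field \<Lambda> (\<lambda>j. t * \<omega> j)"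
      by (simp add: fun_eq_iff zero boundary_field_scale)
    then show "\<bar>cov (gibbs \<Lambda> (\<lambda>i. boundary_field \<Lambda> (\<lambda>_. 0) i + t * (boundary_field \<Lambda> \<omega> i - boundary_field \<Lambda> (\<lambda>_. 0) i))) f (\<lambda>x. x j)\<bar>
        \<le> influence A j"
      using local_cov_le_influence[OF fin A j tempered_scale[OF temp] f f01 f_local] by simp
  qed
  also have "\<dots> \<le> (\<Sum>i\<in>\<Lambda>. influence A i * (\<Sum>\<^sub>\<infinity>j\<in>- \<Lambda>. \<bar>M i j\<bar> * \<bar>\<omega> j\<bar>))"
  proof (intro sum_mono mult_left_mono influence_nonneg)
    fix i assume i: "i \<in> \<Lambda>"
    have "(\<lambda>j. norm (M i j * \<omega> j)) summable_on - \<Lambda>"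
      using temp i by (simp add: tempered_def abs_mult)
    from norm_infsum_bound[OF this]
    show "\<bar>boundary_field \<Lambda> \<omega> i - boundary_field \<Lambda> (\<lambda>_. 0) i\<bar> \<le> (\<Sum>\<^sub>\<infinity>j\<in>- \<Lambda>. \<bar>M i j\<bar> * \<bar>\<omega> j\<bar>)"
      by (simp add: zero) (simp add: boundary_field_def abs_mult)
  qed
  finally show ?thesis by (simp add: finite_volume_gibbs_eq)
qed

text \<open>
The coefficient that remains in front of the first moments when the bound of
\<open>finite_volume_boundary_sensitivity\<close> is averaged over random boundary values.
\<close>

definition boundary_weight :: "(int ^ 'd) set \<Rightarrow> (int ^ 'd) set \<Rightarrow> real" where
  "boundary_weight A \<Lambda> = (\<Sum>i\<in>\<Lambda>. influence A i * (\<Sum>\<^sub>\<infinity>j\<in>- \<Lambda>. \<bar>M i j\<bar>))"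

lemma boundary_weight_nonneg: "0 \<le> boundary_weight A \<Lambda>"
  unfolding boundary_weight_def by (intro sum_nonneg mult_nonneg_nonneg influence_nonneg infsum_nonneg) auto

text \<open>
A double sum over \<open>i\<close> inside and \<open>j\<close> outside \<open>\<Lambda>\<close>. Outside a finite set \<open>F\<close> the total influence is small and the
off-diagonal row sums of \<open>M\<close> are bounded; for the finitely many \<open>i\<close> in \<open>F\<close> the volume can be enlarged until the tails of the rows are small.
\<close>

lemma boundary_weight_small:
  assumes A: "finite A" and e: "0 < \<epsilon>"
  obtains \<Lambda> where "finite \<Lambda>" "A \<subseteq> \<Lambda>" "boundary_weight A \<Lambda> \<le> \<epsilon>"
proof -
  define T where "T = infsum (influence A) UNIV"
  have T: "0 \<le> T" unfolding T_def by (intro infsum_nonneg influence_nonneg)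
  define e1 where "e1 = \<epsilon> / (2 * (1 + C1 * S))"
  define e2 where "e2 = \<epsilon> / (2 * (1 + T))"
  have CS: "0 \<le> C1 * S" using C1_nonneg S_ge_1 by simp
  have pos: "0 < e1" "0 < e2" using e T CS by (auto simp: e1_def e2_def)
  obtain F where F: "finite F" "\<And>G. F \<subseteq> G \<Longrightarrow> infsum (influence A) (- G) \<le> e1"
    using summable_on_small_tail[OF influence_summable[OF A] influence_nonneg pos(1)]
    by (auto simp: Compl_eq_Diff_UNIV)
  have "\<forall>i. \<exists>F. finite F \<and> (\<forall>G. F \<subseteq> G \<longrightarrow> i \<in> G \<longrightarrow> (\<Sum>\<^sub>\<infinity>j\<in>- G. \<bar>M i j\<bar>) \<le> e2)"
  proof
    fix i
    obtain F where F: "finite F" "F \<subseteq> - {i}"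
        "\<And>G. F \<subseteq> G \<Longrightarrow> G \<subseteq> - {i} \<Longrightarrow> (\<Sum>\<^sub>\<infinity>j\<in>- {i} - G. \<bar>M i j\<bar>) \<le> e2"
      by (rule summable_on_small_tail[OF M_summable[of i] abs_ge_zero pos(2)]) blast
    have "(\<Sum>\<^sub>\<infinity>j\<in>- G. \<bar>M i j\<bar>) \<le> e2" if "F \<subseteq> G" "i \<in> G" for G
    proof -
      have "- {i} - (G - {i}) = - G" using that by auto
      then show ?thesis using F(3)[of "G - {i}"] F(2) that by auto
    qed
    with F(1) show "\<exists>F. finite F \<and> (\<forall>G. F \<subseteq> G \<longrightarrow> i \<in> G \<longrightarrow> (\<Sum>\<^sub>\<infinity>j\<in>- G. \<bar>M i j\<bar>) \<le> e2)"
      by blast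
  qed
  from choice[OF this] obtain N where
    "\<forall>i. finite (N i) \<and> (\<forall>G. N i \<subseteq> G \<longrightarrow> i \<in> G \<longrightarrow> (\<Sum>\<^sub>\<infinity>j\<in>- G. \<bar>M i j\<bar>) \<le> e2)" ..
  then have N: "finite (N i)" "N i \<subseteq> G \<Longrightarrow> i \<in> G \<Longrightarrow> (\<Sum>\<^sub>\<infinity>j\<in>- G. \<bar>M i j\<bar>) \<le> e2" for i G
    by simp_all
  define \<Lambda> where "\<Lambda> = A \<union> F \<union> (\<Union>i\<in>F. N i)"
  have fin: "finite \<Lambda>" using A F N by (auto simp: \<Lambda>_def)
  have "boundary_weight A \<Lambda> = (\<Sum>i\<in>F. influence A i * (\<Sum>\<^sub>\<infinity>j\<in>- \<Lambda>. \<bar>M i j\<bar>))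
      + (\<Sum>i\<in>\<Lambda> - F. influence A i * (\<Sum>\<^sub>\<infinity>j\<in>- \<Lambda>. \<bar>M i j\<bar>))"
    unfolding boundary_weight_def using fin by (subst sum.subset_diff[of F]) (auto simp: \<Lambda>_def)
  also have "(\<Sum>i\<in>F. influence A i * (\<Sum>\<^sub>\<infinity>j\<in>- \<Lambda>. \<bar>M i j\<bar>)) \<le> (\<Sum>i\<in>F. influence A i * e2)"
    by (intro sum_mono mult_left_mono influence_nonneg N(2)) (auto simp: \<Lambda>_def)
  also have "\<dots> = sum (influence A) F * e2" by (simp add: sum_distrib_right)
  also have "\<dots> \<le> T * e2"
    using pos finite_sum_le_infsum[OF influence_summable[OF A] F(1)] influence_nonneg
    by (intro mult_right_mono) (auto simp: T_def)
  also have "(\<Sum>i\<in>\<Lambda> - F. influence A i * (\<Sum>\<^sub>\<infinity>j\<in>- \<Lambda>. \<bar>M i j\<bar>)) \<le> (\<Sum>i\<in>\<Lambda> - F. influence A i * (C1 * S))"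
    by (intro sum_mono mult_left_mono influence_nonneg M_sum_le) auto
  also have "\<dots> = sum (influence A) (\<Lambda> - F) * (C1 * S)" by (simp add: sum_distrib_right)
  also have "\<dots> \<le> e1 * (C1 * S)"
  proof (rule mult_right_mono[OF _ CS])
    have "sum (influence A) (\<Lambda> - F) \<le> infsum (influence A) (- F)"
      using fin influence_nonneg summable_on_subset_banach[OF influence_summable[OF A]]
      by (intro finite_sum_le_infsum) auto
    also have "\<dots> \<le> e1" by (intro F(2)) simp
    finally show "sum (influence A) (\<Lambda> - F) \<le> e1" .
  qed
  also have "T * e2 + e1 * (C1 * S) \<le> \<epsilon> / 2 + \<epsilon> / 2"
  proof (rule add_mono)
    show "T * e2 \<le> \<epsilon> / 2" using e T by (simp add: e2_def field_simps)
    show "e1 * (C1 * S) \<le> \<epsilon> / 2" using e CS by (simp add: e1_def field_simps)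
  qed
  finally have "boundary_weight A \<Lambda> \<le> \<epsilon>" by simp
  with fin show ?thesis by (intro that[of \<Lambda>]) (auto simp: \<Lambda>_def)
qed

section \<open>Infinite-volume Gibbs measures\<close>

text \<open>
The sum over the boundary sites is written as an integral over a counting measure, so that Tonelli gives both
measurability and the interchange with the expectation.
\<close>

lemma expected_boundary_influence:
  fixes \<mu> :: "'d config measure" and A :: "(int ^ 'd) set"
  assumes fin: "finite \<Lambda>"
    and prob: "prob_space \<mu>" and sets: "sets \<mu> = sets (PiM UNIV (\<lambda>_. borel))"
    and D: "\<And>j. (\<integral>\<^sup>+x. ennreal \<bar>x j\<bar> \<partial>\<mu>) \<le> ennreal D" and D0: "0 \<le> D"
  defines "R \<equiv> \<lambda>y. \<Sum>i\<in>\<Lambda>. ennreal (influence A i) * (\<integral>\<^sup>+j. ennreal (\<bar>M i j\<bar> * \<bar>y j\<bar>) \<partial>count_space (- \<Lambda>))"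
  shows "R \<in> borel_measurable (PiM (- \<Lambda>) (\<lambda>_. borel))"
    and "(\<integral>\<^sup>+y. R y \<partial>outer_marginal \<mu> \<Lambda>) \<le> ennreal (D * boundary_weight A \<Lambda>)"
proof -
  interpret mu: prob_space \<mu> by fact
  have restr [measurable]: "(\<lambda>x. restrict x (- \<Lambda>)) \<in> measurable \<mu> (PiM (- \<Lambda>) (\<lambda>_. borel))"
    unfolding measurable_cong_sets[OF sets refl] by (rule measurable_restrict_subset) simp
  define Om where "Om = outer_marginal \<mu> \<Lambda>"
  have sets_O [measurable_cong]: "sets Om = sets (PiM (- \<Lambda>) (\<lambda>_. borel))"
    by (simp add: Om_def outer_marginal_def)
  interpret Om: prob_space Om
    unfolding Om_def outer_marginal_def by (rule mu.prob_space_distr[OF restr])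
  interpret C: sigma_finite_measure "count_space (- \<Lambda>)"
    by (rule sigma_finite_measure_count_space_countable) simp
  interpret P: pair_sigma_finite "count_space (- \<Lambda>)" Om ..
  have coord: "(\<lambda>y. y j) \<in> borel_measurable (PiM (- \<Lambda>) (\<lambda>_. borel))" if "j \<in> - \<Lambda>" for j
    by (rule measurable_component_singleton[OF that])
  have joint: "(\<lambda>(j, y). ennreal (\<bar>M i j\<bar> * \<bar>y j\<bar>)) \<in> borel_measurable (count_space (- \<Lambda>) \<Otimes>\<^sub>M Om)" for i
  proof (rule measurable_pair_measure_countable1)
    fix j assume "j \<in> - \<Lambda>"
    note coord[OF this, measurable]
    have "(\<lambda>y. ennreal (\<bar>M i j\<bar> * \<bar>y j\<bar>)) \<in> borel_measurable Om" by measurable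
    then show "(\<lambda>y. case (j, y) of (j, y) \<Rightarrow> ennreal (\<bar>M i j\<bar> * \<bar>y j\<bar>)) \<in> borel_measurable Om" by simp
  qed simp
  have inner: "(\<lambda>y. \<integral>\<^sup>+j. ennreal (\<bar>M i j\<bar> * \<bar>y j\<bar>) \<partial>count_space (- \<Lambda>)) \<in> borel_measurable Om" for i
    using measurable_pair_swap[OF joint[of i]] by (intro C.borel_measurable_nn_integral) (simp add: case_prod_unfold)
  have R: "R \<in> borel_measurable Om"
    unfolding R_def using inner by measurable
  then show "R \<in> borel_measurable (PiM (- \<Lambda>) (\<lambda>_. borel))"
    by (simp add: measurable_cong_sets[OF sets_O refl])
  have site: "(\<integral>\<^sup>+y. \<integral>\<^sup>+j. ennreal (\<bar>M i j\<bar> * \<bar>y j\<bar>) \<partial>count_space (- \<Lambda>) \<partial>Om)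
      \<le> ennreal (D * (\<Sum>\<^sub>\<infinity>j\<in>- \<Lambda>. \<bar>M i j\<bar>))" if i: "i \<in> \<Lambda>" for i
  proof -
    have "(\<integral>\<^sup>+y. \<integral>\<^sup>+j. ennreal (\<bar>M i j\<bar> * \<bar>y j\<bar>) \<partial>count_space (- \<Lambda>) \<partial>Om)
       = (\<integral>\<^sup>+j. \<integral>\<^sup>+y. ennreal (\<bar>M i j\<bar> * \<bar>y j\<bar>) \<partial>Om \<partial>count_space (- \<Lambda>))"
      by (rule P.Fubini'[OF joint])
    also have "\<dots> \<le> (\<integral>\<^sup>+j. ennreal (D * \<bar>M i j\<bar>) \<partial>count_space (- \<Lambda>))"
    proof (rule nn_integral_mono)
      fix j assume j: "j \<in> space (count_space (- \<Lambda>))"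
      then have [measurable]: "(\<lambda>y. y j) \<in> borel_measurable (PiM (- \<Lambda>) (\<lambda>_. borel))" by (intro coord) simp
      have "(\<integral>\<^sup>+y. ennreal (\<bar>M i j\<bar> * \<bar>y j\<bar>) \<partial>Om) = ennreal \<bar>M i j\<bar> * (\<integral>\<^sup>+y. ennreal \<bar>y j\<bar> \<partial>Om)"
        by (simp add: ennreal_mult' nn_integral_cmult)
      also have "(\<integral>\<^sup>+y. ennreal \<bar>y j\<bar> \<partial>Om) = (\<integral>\<^sup>+x. ennreal \<bar>x j\<bar> \<partial>\<mu>)"
        unfolding Om_def outer_marginal_def using j by (subst nn_integral_distr[OF restr]) auto
      also have "ennreal \<bar>M i j\<bar> * \<dots> \<le> ennreal \<bar>M i j\<bar> * ennreal D"
        by (intro mult_left_mono D) simp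
      also have "\<dots> = ennreal (D * \<bar>M i j\<bar>)"
        by (simp add: ennreal_mult D0 mult.commute)
      finally show "(\<integral>\<^sup>+y. ennreal (\<bar>M i j\<bar> * \<bar>y j\<bar>) \<partial>Om) \<le> ennreal (D * \<bar>M i j\<bar>)" .
    qed
    also have "\<dots> = ennreal (\<Sum>\<^sub>\<infinity>j\<in>- \<Lambda>. D * \<bar>M i j\<bar>)"
      using summable_on_subset_banach[OF M_summable[of i], of "- \<Lambda>"] i D0
      by (intro nn_integral_count_space_infsum summable_on_cmult_right) auto
    also have "(\<Sum>\<^sub>\<infinity>j\<in>- \<Lambda>. D * \<bar>M i j\<bar>) = D * (\<Sum>\<^sub>\<infinity>j\<in>- \<Lambda>. \<bar>M i j\<bar>)"
      by (rule infsum_cmult_right')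
    finally show ?thesis .
  qed
  have "(\<integral>\<^sup>+y. R y \<partial>Om)
      = (\<Sum>i\<in>\<Lambda>. ennreal (influence A i) * (\<integral>\<^sup>+y. \<integral>\<^sup>+j. ennreal (\<bar>M i j\<bar> * \<bar>y j\<bar>) \<partial>count_space (- \<Lambda>) \<partial>Om))"
    unfolding R_def using inner by (simp add: nn_integral_sum nn_integral_cmult)
  also have "\<dots> \<le> (\<Sum>i\<in>\<Lambda>. ennreal (influence A i) * ennreal (D * (\<Sum>\<^sub>\<infinity>j\<in>- \<Lambda>. \<bar>M i j\<bar>)))"
    by (intro sum_mono mult_left_mono site) auto
  also have "\<dots> = (\<Sum>i\<in>\<Lambda>. ennreal (influence A i * (D * (\<Sum>\<^sub>\<infinity>j\<in>- \<Lambda>. \<bar>M i j\<bar>))))"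
    by (simp add: ennreal_mult' influence_nonneg)
  also have "\<dots> = ennreal (\<Sum>i\<in>\<Lambda>. influence A i * (D * (\<Sum>\<^sub>\<infinity>j\<in>- \<Lambda>. \<bar>M i j\<bar>)))"
    by (rule sum_ennreal) (auto intro!: mult_nonneg_nonneg influence_nonneg D0 infsum_nonneg)
  also have "(\<Sum>i\<in>\<Lambda>. influence A i * (D * (\<Sum>\<^sub>\<infinity>j\<in>- \<Lambda>. \<bar>M i j\<bar>))) = D * boundary_weight A \<Lambda>"
    by (simp add: boundary_weight_def sum_distrib_left mult_ac)
  finally show "(\<integral>\<^sup>+y. R y \<partial>outer_marginal \<mu> \<Lambda>) \<le> ennreal (D * boundary_weight A \<Lambda>)"
    unfolding Om_def .
qed

text \<open>
The probability of a cylinder is the average of its finite-volume probabilities over the boundary values.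
Comparing each of them with the one for zero boundary values makes the reference quantity independent of \<open>\<mu>\<close>.
\<close>

lemma gibbs_cylinder_approximation:
  fixes \<mu> :: "'d config measure" and X :: "int ^ 'd \<Rightarrow> real set"
  assumes mu: "infinite_volume_gibbs \<psi> M \<mu>"
    and fin: "finite \<Lambda>" and A: "A \<subseteq> \<Lambda>" and X: "\<And>k. k \<in> A \<Longrightarrow> X k \<in> sets borel"
    and D: "\<And>j. (\<integral>\<^sup>+x. ennreal \<bar>x j\<bar> \<partial>\<mu>) \<le> ennreal D" and D0: "0 \<le> D"
  shows "\<bar>measure \<mu> {x. \<forall>k\<in>A. x k \<in> X k}
      - (LINT x|finite_volume_gibbs \<psi> M \<Lambda> (\<lambda>_. 0). indicator {x. \<forall>k\<in>A. x k \<in> X k} x)\<bar>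
     \<le> D * boundary_weight A \<Lambda>"
proof -
  define E where "E = {x :: 'd config. \<forall>k\<in>A. x k \<in> X k}"
  define f where "f = (indicator E :: 'd config \<Rightarrow> real)"
  define \<phi> where "\<phi> = (\<lambda>y. LINT x|finite_volume_gibbs \<psi> M \<Lambda> y. f x)"
  have prob: "prob_space \<mu>" and sets: "sets \<mu> = sets (PiM UNIV (\<lambda>_. borel))"
    using mu by (auto simp: infinite_volume_gibbs_def)
  interpret mu: prob_space \<mu> by fact
  obtain \<kappa> where cond: "conditional_measure \<mu> \<Lambda> \<kappa>"
    and \<kappa>: "AE y in outer_marginal \<mu> \<Lambda>. tempered M \<Lambda> y \<and> \<kappa> y = finite_volume_gibbs \<psi> M \<Lambda> y"
    using mu fin unfolding infinite_volume_gibbs_def by blast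
  have finA: "finite A" using A fin by (rule finite_subset)
  have E_meas: "E \<inter> space (PiM I (\<lambda>_. borel)) \<in> sets (PiM I (\<lambda>_. borel))" if "A \<subseteq> I" for I
  proof -
    have "E \<inter> space (PiM I (\<lambda>_. borel)) = {x \<in> space (PiM I (\<lambda>_. borel)). \<forall>k\<in>A. x k \<in> X k}"
      by (auto simp: E_def)
    also have "\<dots> \<in> sets (PiM I (\<lambda>_. borel))"
    proof (rule sets.sets_Collect_finite_All[OF _ finA])
      fix k assume k: "k \<in> A"
      have "(\<lambda>x. x k) \<in> measurable (PiM I (\<lambda>_. borel)) borel"
        using measurable_component_singleton[of k I "\<lambda>_. borel"] k that by auto
      from measurable_sets[OF this X[OF k]]
      show "{x \<in> space (PiM I (\<lambda>_. borel)). x k \<in> X k} \<in> sets (PiM I (\<lambda>_. borel))"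
        by (simp add: vimage_def Int_def conj_commute)
    qed
    finally show ?thesis .
  qed
  have f_meas: "f \<in> borel_measurable (Leb \<Lambda>)"
  proof -
    have "sets (Leb \<Lambda> :: 'd config measure) = sets (PiM \<Lambda> (\<lambda>_. borel))"
      by (intro sets_PiM_cong) auto
    then show ?thesis
      using E_meas[OF A] unfolding f_def by (subst borel_measurable_indicator_iff) (simp add: Int_commute cong: sets_eq_imp_space_eq)
  qed
  have f01: "0 \<le> f x" "f x \<le> 1" for x by (auto simp: f_def indicator_def)
  have f_local: "f x = f y" if "\<And>k. k \<in> A \<Longrightarrow> x k = y k" for x y
    using that by (auto simp: f_def E_def indicator_def)
  define R where "R = (\<lambda>y. \<Sum>i\<in>\<Lambda>. ennreal (influence A i) * (\<integral>\<^sup>+j. ennreal (\<bar>M i j\<bar> * \<bar>y j\<bar>) \<partial>count_space (- \<Lambda>)))"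
  define Om where "Om = outer_marginal \<mu> \<Lambda>"
  have restr: "(\<lambda>x. restrict x (- \<Lambda>)) \<in> measurable \<mu> (PiM (- \<Lambda>) (\<lambda>_. borel))"
    unfolding measurable_cong_sets[OF sets refl] by (rule measurable_restrict_subset) simp
  interpret Om: prob_space Om
    unfolding Om_def outer_marginal_def by (rule mu.prob_space_distr[OF restr])
  have R [measurable]: "R \<in> borel_measurable Om" and R_int: "(\<integral>\<^sup>+y. R y \<partial>Om) \<le> ennreal (D * boundary_weight A \<Lambda>)"
    using expected_boundary_influence[OF fin prob sets D D0, where A = A]
    by (auto simp: R_def Om_def outer_marginal_def)
  have \<phi>_R: "ennreal (\<phi> y) \<le> ennreal (\<phi> (\<lambda>_. 0)) + R y \<and> ennreal (\<phi> (\<lambda>_. 0)) \<le> ennreal (\<phi> y) + R y"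
    if temp: "tempered M \<Lambda> y" for y
  proof -
    define r where "r = (\<Sum>i\<in>\<Lambda>. influence A i * (\<Sum>\<^sub>\<infinity>j\<in>- \<Lambda>. \<bar>M i j\<bar> * \<bar>y j\<bar>))"
    have r0: "0 \<le> r" unfolding r_def by (intro sum_nonneg mult_nonneg_nonneg influence_nonneg infsum_nonneg) auto
    have "R y = (\<Sum>i\<in>\<Lambda>. ennreal (influence A i * (\<Sum>\<^sub>\<infinity>j\<in>- \<Lambda>. \<bar>M i j\<bar> * \<bar>y j\<bar>)))"
      unfolding R_def using temp
      by (intro sum.cong refl) (subst nn_integral_count_space_infsum, auto simp: tempered_def ennreal_mult' influence_nonneg)
    also have "\<dots> = ennreal r"
      unfolding r_def by (rule sum_ennreal) (intro mult_nonneg_nonneg influence_nonneg infsum_nonneg; simp)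
    finally have Rr: "R y = ennreal r" .
    have "\<bar>\<phi> y - \<phi> (\<lambda>_. 0)\<bar> \<le> r"
      unfolding \<phi>_def r_def by (rule finite_volume_boundary_sensitivity[OF fin A temp f_meas f01 f_local])
    moreover have "0 \<le> \<phi> z" for z
      unfolding \<phi>_def by (rule Bochner_Integration.integral_nonneg) (rule f01)
    ultimately show ?thesis
      unfolding Rr using r0 by (auto simp: ennreal_plus[symmetric] abs_le_iff simp del: ennreal_plus)
  qed
  have "emeasure \<mu> E = (\<integral>\<^sup>+x. indicator E x \<partial>\<mu>)"
    using E_meas[of UNIV] sets by (simp add: space_PiM)
  also have "\<dots> = (\<integral>\<^sup>+y. (\<integral>\<^sup>+x. indicator E (merge \<Lambda> (- \<Lambda>) (x, y)) \<partial>\<kappa> y) \<partial>Om)"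
  proof -
    have "(indicator E :: 'd config \<Rightarrow> ennreal) \<in> borel_measurable (PiM UNIV (\<lambda>_. borel))"
      using E_meas[of UNIV] by (simp add: space_PiM)
    then show ?thesis using cond unfolding conditional_measure_def Om_def by blast
  qed
  finally have mu_E: "emeasure \<mu> E = (\<integral>\<^sup>+y. (\<integral>\<^sup>+x. indicator E (merge \<Lambda> (- \<Lambda>) (x, y)) \<partial>\<kappa> y) \<partial>Om)" .
  have inner: "(\<integral>\<^sup>+x. indicator E (merge \<Lambda> (- \<Lambda>) (x, y)) \<partial>\<kappa> y) = ennreal (\<phi> y)"
    if "\<kappa> y = finite_volume_gibbs \<psi> M \<Lambda> y" for y
  proof -
    have "(\<integral>\<^sup>+x. indicator E (merge \<Lambda> (- \<Lambda>) (x, y)) \<partial>\<kappa> y) = (\<integral>\<^sup>+x. ennreal (f x) \<partial>\<kappa> y)"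
      using A by (intro nn_integral_cong) (auto simp: f_def E_def indicator_def subset_iff)
    also have "\<dots> = ennreal (\<phi> y)"
      unfolding \<phi>_def that finite_volume_gibbs_eq
      using f_meas f01 by (intro nn_integral_eq_integral integrable_gibbs fin moderate_bounded[where C = 1]) auto
    finally show ?thesis .
  qed
  \<comment> \<open>Additivity of the integral needs measurability of the conditional probability in the boundary values,
    which comes from that of the kernel \<open>\<kappa>\<close>.\<close>
  have m: "(\<lambda>y. \<integral>\<^sup>+x. indicator E (merge \<Lambda> (- \<Lambda>) (x, y)) \<partial>\<kappa> y) \<in> borel_measurable Om"
  proof -
    have K: "\<kappa> \<in> measurable (PiM (- \<Lambda>) (\<lambda>_. borel)) (subprob_algebra (PiM \<Lambda> (\<lambda>_. borel)))"
      using cond by (auto simp: conditional_measure_def intro: measurable_prob_algebraD)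
    have mrg: "(\<lambda>(y, x). merge \<Lambda> (- \<Lambda>) (x, y)) \<in>
        measurable (PiM (- \<Lambda>) (\<lambda>_. borel) \<Otimes>\<^sub>M PiM \<Lambda> (\<lambda>_. borel)) (PiM UNIV (\<lambda>_. borel :: real measure))"
      using measurable_merge[of "- \<Lambda>" \<Lambda> "\<lambda>_. borel :: real measure"]
      by (simp add: merge_commute[of \<Lambda> "- \<Lambda>"] case_prod_unfold)
    have "(indicator E :: 'd config \<Rightarrow> ennreal) \<in> borel_measurable (PiM UNIV (\<lambda>_. borel))"
      using E_meas[of UNIV] by (simp add: space_PiM)
    from measurable_compose[OF mrg this]
    have "(\<lambda>(y, x). indicator E (merge \<Lambda> (- \<Lambda>) (x, y)) :: ennreal)
        \<in> borel_measurable (PiM (- \<Lambda>) (\<lambda>_. borel) \<Otimes>\<^sub>M PiM \<Lambda> (\<lambda>_. borel))"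
      by (simp add: case_prod_unfold)
    from nn_integral_measurable_subprob_algebra2[OF this K] show ?thesis
      by (simp add: Om_def outer_marginal_def)
  qed
  have c: "(\<integral>\<^sup>+y. c \<partial>Om) = c" for c :: ennreal
    by (simp add: Om.emeasure_space_1)
  have "emeasure \<mu> E \<le> (\<integral>\<^sup>+y. ennreal (\<phi> (\<lambda>_. 0)) + R y \<partial>Om)"
    unfolding mu_E
  proof (rule nn_integral_mono_AE)
    show "AE y in Om. (\<integral>\<^sup>+x. indicator E (merge \<Lambda> (- \<Lambda>) (x, y)) \<partial>\<kappa> y)
        \<le> ennreal (\<phi> (\<lambda>_. 0)) + R y"
      using \<kappa>[folded Om_def] by eventually_elim (metis inner \<phi>_R)
  qed
  also have "\<dots> \<le> ennreal (\<phi> (\<lambda>_. 0)) + ennreal (D * boundary_weight A \<Lambda>)"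
    using R_int by (subst nn_integral_add) (auto simp: Om.emeasure_space_1 intro: add_left_mono)
  finally have up: "emeasure \<mu> E \<le> ennreal (\<phi> (\<lambda>_. 0)) + ennreal (D * boundary_weight A \<Lambda>)" .
  have "ennreal (\<phi> (\<lambda>_. 0)) = (\<integral>\<^sup>+y. ennreal (\<phi> (\<lambda>_. 0)) \<partial>Om)" by (rule c[symmetric])
  also have "\<dots> \<le> (\<integral>\<^sup>+y. (\<integral>\<^sup>+x. indicator E (merge \<Lambda> (- \<Lambda>) (x, y)) \<partial>\<kappa> y) + R y \<partial>Om)"
  proof (rule nn_integral_mono_AE)
    show "AE y in Om. ennreal (\<phi> (\<lambda>_. 0))
        \<le> (\<integral>\<^sup>+x. indicator E (merge \<Lambda> (- \<Lambda>) (x, y)) \<partial>\<kappa> y) + R y"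
      using \<kappa>[folded Om_def] by eventually_elim (metis inner \<phi>_R)
  qed
  also have "\<dots> \<le> emeasure \<mu> E + ennreal (D * boundary_weight A \<Lambda>)"
    unfolding mu_E using R_int m by (subst nn_integral_add) (auto intro: add_left_mono)
  finally have lo: "ennreal (\<phi> (\<lambda>_. 0)) \<le> emeasure \<mu> E + ennreal (D * boundary_weight A \<Lambda>)" .
  have nn: "0 \<le> D * boundary_weight A \<Lambda>" "0 \<le> \<phi> (\<lambda>_. 0)"
    using D0 boundary_weight_nonneg unfolding \<phi>_def
    by (auto intro!: mult_nonneg_nonneg Bochner_Integration.integral_nonneg f01)
  have "\<bar>measure \<mu> E - \<phi> (\<lambda>_. 0)\<bar> \<le> D * boundary_weight A \<Lambda>"
    using up lo nn unfolding mu.emeasure_eq_measure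
    by (simp add: ennreal_plus[symmetric] abs_le_iff del: ennreal_plus)
  then show ?thesis by (simp add: E_def \<phi>_def f_def)
qed

lemma first_moment_bound:
  fixes \<mu> :: "'d config measure"
  assumes prob: "prob_space \<mu>" and sets: "sets \<mu> = sets (PiM UNIV (\<lambda>_. borel))"
    and sup: "(SUP i. \<integral>\<^sup>+ x. ennreal ((x i)\<^sup>2) \<partial>\<mu>) < \<infinity>"
  obtains D where "0 \<le> D" "\<And>j. (\<integral>\<^sup>+x. ennreal \<bar>x j\<bar> \<partial>\<mu>) \<le> ennreal D"
proof -
  interpret prob_space \<mu> by fact
  define s where "s = enn2real (SUP i. \<integral>\<^sup>+ x. ennreal ((x i)\<^sup>2) \<partial>\<mu>)"
  have s: "(SUP i. \<integral>\<^sup>+ x. ennreal ((x i)\<^sup>2) \<partial>\<mu>) = ennreal s"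
    using sup by (simp add: s_def)
  have "(\<integral>\<^sup>+x. ennreal \<bar>x j\<bar> \<partial>\<mu>) \<le> ennreal (1 + s)" for j
  proof -
    have [measurable]: "(\<lambda>x. x j) \<in> borel_measurable \<mu>"
      unfolding measurable_cong_sets[OF sets refl] by (rule measurable_component_singleton) simp
    have "(\<integral>\<^sup>+x. ennreal \<bar>x j\<bar> \<partial>\<mu>) \<le> (\<integral>\<^sup>+x. 1 + ennreal ((x j)\<^sup>2) \<partial>\<mu>)"
    proof (rule nn_integral_mono)
      fix x :: "'d config"
      have "0 \<le> (\<bar>x j\<bar> - 1)\<^sup>2" by simp
      then have "\<bar>x j\<bar> \<le> 1 + (x j)\<^sup>2" unfolding power2_diff by simp
      then have "ennreal \<bar>x j\<bar> \<le> ennreal (1 + (x j)\<^sup>2)" by (rule ennreal_leI)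
      then show "ennreal \<bar>x j\<bar> \<le> 1 + ennreal ((x j)\<^sup>2)" by simp
    qed
    also have "\<dots> = 1 + (\<integral>\<^sup>+x. ennreal ((x j)\<^sup>2) \<partial>\<mu>)"
      by (subst nn_integral_add) (auto simp: emeasure_space_1)
    also have "\<dots> \<le> 1 + ennreal s"
      unfolding s[symmetric] by (intro add_left_mono SUP_upper) simp
    finally show ?thesis by (simp add: s_def)
  qed
  then show ?thesis by (intro that[of "1 + s"]) (auto simp: s_def)
qed

theorem at_most_one_gibbs_measure:
  "\<exists>\<^sub>\<le>\<^sub>1 \<mu>. infinite_volume_gibbs \<psi> M \<mu> \<and> (SUP i. \<integral>\<^sup>+ x. ennreal ((x i)\<^sup>2) \<partial>\<mu>) < \<infinity>"
proof (rule Uniq_I)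
  fix \<mu> \<nu> :: "'d config measure"
  assume mu: "infinite_volume_gibbs \<psi> M \<mu> \<and> (SUP i. \<integral>\<^sup>+ x. ennreal ((x i)\<^sup>2) \<partial>\<mu>) < \<infinity>"
    and nu: "infinite_volume_gibbs \<psi> M \<nu> \<and> (SUP i. \<integral>\<^sup>+ x. ennreal ((x i)\<^sup>2) \<partial>\<nu>) < \<infinity>"
  have p: "prob_space \<mu>" "prob_space \<nu>" and s: "sets \<mu> = sets (PiM UNIV (\<lambda>_. borel))" "sets \<nu> = sets (PiM UNIV (\<lambda>_. borel))"
    using mu nu by (auto simp: infinite_volume_gibbs_def)
  interpret mu: prob_space \<mu> by fact
  interpret nu: prob_space \<nu> by fact
  obtain D where D: "0 \<le> D" "\<And>j. (\<integral>\<^sup>+x. ennreal \<bar>x j\<bar> \<partial>\<mu>) \<le> ennreal D"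
    using first_moment_bound[OF p(1) s(1)] mu by blast
  obtain D' where D': "0 \<le> D'" "\<And>j. (\<integral>\<^sup>+x. ennreal \<bar>x j\<bar> \<partial>\<nu>) \<le> ennreal D'"
    using first_moment_bound[OF p(2) s(2)] nu by blast
  show "\<mu> = \<nu>"
  proof (rule measure_eqI_PiM_infinite[OF s])
    fix X :: "int ^ 'd \<Rightarrow> real set" and A :: "(int ^ 'd) set"
    assume A: "finite A" and X: "\<And>i. i \<in> A \<Longrightarrow> X i \<in> sets borel"
    define E where "E = {x. \<forall>k\<in>A. x k \<in> X k}"
    have emb: "prod_emb UNIV (\<lambda>_. borel) A (Pi\<^sub>E A X) = E"
      by (auto simp: prod_emb_def E_def)
    \<comment> \<open>Both probabilities are close to the same finite-volume probability with zero boundary values.\<close>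
    have "\<bar>measure \<mu> E - measure \<nu> E\<bar> \<le> e" if e: "0 < e" for e
    proof -
      define \<epsilon> where "\<epsilon> = e / (D + D' + 1)"
      have "0 < \<epsilon>" using e D(1) D'(1) by (simp add: \<epsilon>_def)
      then obtain \<Lambda> where \<Lambda>: "finite \<Lambda>" "A \<subseteq> \<Lambda>" "boundary_weight A \<Lambda> \<le> \<epsilon>"
        using boundary_weight_small[OF A] by blast
      have "\<bar>measure \<mu> E - measure \<nu> E\<bar> \<le> D * boundary_weight A \<Lambda> + D' * boundary_weight A \<Lambda>"
        using gibbs_cylinder_approximation[where X = X, OF conjunct1[OF mu] \<Lambda>(1,2) X D(2,1)]
          gibbs_cylinder_approximation[where X = X, OF conjunct1[OF nu] \<Lambda>(1,2) X D'(2,1)]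
        unfolding E_def by linarith
      also have "\<dots> \<le> (D + D') * \<epsilon>"
        using \<Lambda>(3) D(1) D'(1) by (simp add: distrib_right[symmetric] mult_left_mono)
      also have "\<dots> \<le> e" using e D(1) D'(1) by (simp add: \<epsilon>_def field_simps)
      finally show ?thesis .
    qed
    then have "\<bar>measure \<mu> E - measure \<nu> E\<bar> \<le> 0" by (rule field_le_epsilon) simp
    then show "emeasure \<mu> (prod_emb UNIV (\<lambda>_. borel) A (Pi\<^sub>E A X)) = emeasure \<nu> (prod_emb UNIV (\<lambda>_. borel) A (Pi\<^sub>E A X))"
      by (simp add: emb mu.emeasure_eq_measure nu.emeasure_eq_measure)
  qed (rule mu.finite_measure_axioms)
qed

end

section \<open>Summability of algebraic decay on the lattice\<close>

text \<open>
One factor per coordinate: the decay \<open>\<bar>i - j\<bar>\<^bsup>-p\<^esup>\<close> on the lattice is dominated by a product of such factors with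
\<open>s = p / d\<close>, which is summable along each axis because \<open>p > d\<close>.
\<close>

definition axis_decay :: "real \<Rightarrow> int \<Rightarrow> real" where
  "axis_decay s m = (max 1 \<bar>real_of_int m\<bar>) powr (- s)"

lemma axis_decay_nonneg: "0 \<le> axis_decay s m"
  by (simp add: axis_decay_def)

lemma axis_decay_sum_bounded:
  assumes "1 < s"
  obtains H where "\<And>N. (\<Sum>m\<in>{- int N..int N}. axis_decay s m) \<le> H"
proof -
  define g where "g = (\<lambda>n. axis_decay s (int n))"
  have "summable (\<lambda>n. real n powr (- s))" using assms by (simp add: summable_real_powr_iff)
  moreover have "eventually (\<lambda>n. real n powr (- s) = g n) sequentially"
    using eventually_ge_at_top[of 1] by eventually_elim (simp add: g_def axis_decay_def max_def)
  ultimately have g: "summable g" by (rule summable_cong[THEN iffD1, rotated])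
  have g_le: "sum g {..N} \<le> suminf g" for N
    using g by (intro sum_le_suminf) (auto simp: g_def axis_decay_nonneg)
  have "(\<Sum>m\<in>{- int N..int N}. axis_decay s m) \<le> 2 * suminf g" for N
  proof -
    define P where "P = int ` {..N}"
    define Q where "Q = (\<lambda>n. - int n) ` {..N}"
    have "{- int N..int N} \<subseteq> P \<union> Q"
    proof
      fix m assume m: "m \<in> {- int N..int N}"
      show "m \<in> P \<union> Q"
      proof (cases "0 \<le> m")
        case True
        then have "m = int (nat m)" "nat m \<le> N" using m by auto
        then show ?thesis unfolding P_def by blast
      next
        case False
        then have "m = - int (nat (- m))" "nat (- m) \<le> N" using m by auto
        then show ?thesis unfolding Q_def by blast
      qed
    qed
    then have "(\<Sum>m\<in>{- int N..int N}. axis_decay s m) \<le> sum (axis_decay s) (P \<union> Q)"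
      by (intro sum_mono2) (auto simp: P_def Q_def axis_decay_nonneg)
    also have "\<dots> \<le> sum (axis_decay s) P + sum (axis_decay s) Q"
      using sum.union_inter[of P Q "axis_decay s"] sum_nonneg[of "P \<inter> Q" "axis_decay s"]
      by (auto simp: P_def Q_def axis_decay_nonneg)
    also have "sum (axis_decay s) P = sum g {..N}"
      unfolding P_def g_def by (subst sum.reindex) (auto simp: inj_on_def)
    also have "sum (axis_decay s) Q = sum g {..N}"
      unfolding Q_def g_def by (subst sum.reindex) (auto simp: inj_on_def axis_decay_def)
    finally show ?thesis using g_le[of N] by simp
  qed
  then show ?thesis by (rule that)
qed

definition lattice_kernel :: "real \<Rightarrow> int ^ 'd \<Rightarrow> int ^ 'd \<Rightarrow> real" where
  "lattice_kernel p i j = (if i = j then 1 else 1 / lattice_dist i j powr p)"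

lemma lattice_dist_commute: "lattice_dist i j = lattice_dist j i"
proof -
  have "(\<chi> k. real_of_int (i $ k - j $ k)) = - (\<chi> k. real_of_int (j $ k - i $ k))"
    by (simp add: vec_eq_iff)
  then show ?thesis unfolding lattice_dist_def by (metis norm_minus_cancel)
qed

lemma lattice_dist_component: "\<bar>real_of_int (i $ k - j $ k)\<bar> \<le> lattice_dist i j"
  using component_le_norm_cart[of "\<chi> k. real_of_int (i $ k - j $ k)" k] by (simp add: lattice_dist_def)

lemma lattice_dist_ge_1:
  assumes "i \<noteq> j" shows "1 \<le> lattice_dist i j"
proof -
  obtain k where "i $ k \<noteq> j $ k" using assms by (auto simp: vec_eq_iff)
  then have "1 \<le> \<bar>i $ k - j $ k\<bar>" by linarith
  then have "1 \<le> \<bar>real_of_int (i $ k - j $ k)\<bar>" by linarith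
  then show ?thesis using lattice_dist_component[of i k j] by linarith
qed

text \<open>
The Euclidean distance dominates \<open>1\<close> and each coordinate difference; distributing the exponent \<open>p\<close> evenly over
the \<open>d\<close> coordinates gives the product.
\<close>

lemma lattice_kernel_le_prod:
  fixes i j :: "int ^ 'd"
  assumes "0 \<le> p"
  shows "lattice_kernel p i j \<le> (\<Prod>k\<in>UNIV. axis_decay (p / real CARD('d)) (j $ k - i $ k))"
proof (cases "i = j")
  case True
  then show ?thesis by (simp add: lattice_kernel_def axis_decay_def)
next
  case False
  define D where "D = lattice_dist i j"
  have D: "1 \<le> D" unfolding D_def by (rule lattice_dist_ge_1[OF False])
  have "lattice_kernel p i j = D powr (- p)"
    using False by (simp add: lattice_kernel_def D_def powr_minus_divide)
  also have "\<dots> = (\<Prod>k\<in>(UNIV :: 'd set). D powr (- (p / real CARD('d))))"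
    using D by (simp add: powr_powr flip: powr_realpow)
  also have "\<dots> \<le> (\<Prod>k\<in>UNIV. axis_decay (p / real CARD('d)) (j $ k - i $ k))"
  proof (rule prod_mono)
    fix k :: 'd
    have "max 1 \<bar>real_of_int (j $ k - i $ k)\<bar> \<le> D"
      using D lattice_dist_component[of j k i] by (simp add: D_def lattice_dist_commute[of j])
    then show "0 \<le> D powr (- (p / real CARD('d))) \<and>
        D powr (- (p / real CARD('d))) \<le> axis_decay (p / real CARD('d)) (j $ k - i $ k)"
      unfolding axis_decay_def using assms D by (auto intro!: powr_mono2')
  qed
  finally show ?thesis .
qed

text \<open>
A finite set of sites lies in a box around \<open>i\<close>, over which the sum of the product is a product of one-dimensional sums.
\<close>

lemma lattice_kernel_sum_bounded:
  assumes "real CARD('d) < p"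
  obtains S where "\<And>F (i :: int ^ 'd). finite F \<Longrightarrow> (\<Sum>j\<in>F. lattice_kernel p i j) \<le> S"
proof -
  define s where "s = p / real CARD('d)"
  have "1 < s" using assms by (simp add: s_def)
  then obtain H where H: "\<And>N. (\<Sum>m\<in>{- int N..int N}. axis_decay s m) \<le> H"
    using axis_decay_sum_bounded by blast
  have "(\<Sum>j\<in>F. lattice_kernel p i j) \<le> H ^ CARD('d)" if F: "finite F" for F and i :: "int ^ 'd"
  proof -
    define N where "N = (\<Sum>j\<in>F. \<Sum>k\<in>UNIV. nat \<bar>j $ k - i $ k\<bar>)"
    define shift where "shift = (\<lambda>g :: 'd \<Rightarrow> int. \<chi> k. i $ k + g k)"
    define Box where "Box = Pi\<^sub>E (UNIV :: 'd set) (\<lambda>_. {- int N..int N})"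
    have "F \<subseteq> shift ` Box"
    proof
      fix j assume j: "j \<in> F"
      have "- int N \<le> j $ k - i $ k \<and> j $ k - i $ k \<le> int N" for k
      proof -
        have "nat \<bar>j $ k - i $ k\<bar> \<le> (\<Sum>k\<in>UNIV. nat \<bar>j $ k - i $ k\<bar>)" by (intro member_le_sum) auto
        also have "\<dots> \<le> N" unfolding N_def using F j by (intro member_le_sum) auto
        finally show ?thesis by linarith
      qed
      then have "(\<lambda>k. j $ k - i $ k) \<in> Box" by (auto simp: Box_def)
      moreover have "j = shift (\<lambda>k. j $ k - i $ k)" by (simp add: shift_def vec_eq_iff)
      ultimately show "j \<in> shift ` Box" by blast
    qed
    moreover have finBox: "finite Box" unfolding Box_def by (intro finite_PiE) auto
    moreover have "0 \<le> lattice_kernel p i j" for j by (simp add: lattice_kernel_def)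
    ultimately have "(\<Sum>j\<in>F. lattice_kernel p i j) \<le> (\<Sum>j\<in>shift ` Box. lattice_kernel p i j)"
      by (intro sum_mono2) auto
    also have "\<dots> = (\<Sum>g\<in>Box. lattice_kernel p i (shift g))"
      by (rule sum.reindex[unfolded comp_def]) (auto simp: inj_on_def shift_def vec_eq_iff)
    also have "\<dots> \<le> (\<Sum>g\<in>Box. \<Prod>k\<in>UNIV. axis_decay s (g k))"
    proof (rule sum_mono)
      fix g
      show "lattice_kernel p i (shift g) \<le> (\<Prod>k\<in>UNIV. axis_decay s (g k))"
        using lattice_kernel_le_prod[of p i "shift g"] assms by (simp add: shift_def s_def)
    qed
    also have "\<dots> = (\<Prod>k\<in>(UNIV :: 'd set). \<Sum>m\<in>{- int N..int N}. axis_decay s m)"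
      unfolding Box_def by (rule prod_sum_PiE[symmetric]) auto
    also have "\<dots> \<le> (\<Prod>k\<in>(UNIV :: 'd set). H)"
      by (rule prod_mono) (auto simp: H sum_nonneg axis_decay_nonneg)
    finally show ?thesis by simp
  qed
  then show ?thesis by (rule that)
qed

section \<open>Uniqueness of the infinite-volume Gibbs measure\<close>

theorem theorem1p14:
  fixes \<psi> \<psi>c \<psi>b :: "int ^ 'd \<Rightarrow> real \<Rightarrow> real"
    and M :: "int ^ 'd \<Rightarrow> int ^ 'd \<Rightarrow> real"
    and \<alpha> \<delta> C0 C1 C2 :: real
  assumes "\<alpha> > 0" and "\<delta> > 0"
    and "\<And>i. smooth (\<psi> i)"
    and "\<And>i z. \<psi> i z = \<psi>c i z + \<psi>b i z"
    and "\<And>i z. \<psi>c i differentiable (at z)"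
    and "\<And>i z. deriv (\<psi>c i) differentiable (at z)"
    and "\<And>i z. deriv (deriv (\<psi>c i)) z \<ge> 0"
    and "\<And>i z. \<psi>b i differentiable (at z)"
    and "\<And>i z. \<bar>\<psi>b i z\<bar> + \<bar>deriv (\<psi>b i) z\<bar> \<le> C0"
    and "\<And>i j. M i j = M j i"
    and "\<And>i. (\<lambda>j. \<bar>M i j\<bar>) summable_on (- {i})"
    and "\<And>i. (\<Sum>\<^sub>\<infinity>j\<in>- {i}. \<bar>M i j\<bar>) + \<delta> \<le> M i i"
    and "\<And>i j. i \<noteq> j \<Longrightarrow> \<bar>M i j\<bar> \<le> C1 / lattice_dist i j powr (real CARD('d) + \<alpha>)"
    and "\<And>\<Lambda> \<omega> i j. finite \<Lambda> \<Longrightarrow> tempered M \<Lambda> \<omega> \<Longrightarrow> i \<in> \<Lambda> \<Longrightarrow> j \<in> \<Lambda> \<Longrightarrow> i \<noteq> j \<Longrightarrow>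
           \<bar>cov (finite_volume_gibbs \<psi> M \<Lambda> \<omega>) (\<lambda>x. x i) (\<lambda>x. x j)\<bar>
             \<le> C2 / lattice_dist i j powr (real CARD('d) + \<alpha>)"
  shows "\<exists>\<^sub>\<le>\<^sub>1 \<mu>. infinite_volume_gibbs \<psi> M \<mu> \<and>
           (SUP i. \<integral>\<^sup>+ x. ennreal ((x i)\<^sup>2) \<partial>\<mu>) < \<infinity>"
proof -
  define p where "p = real CARD('d) + \<alpha>"
  define w where "w = (lattice_kernel p :: int ^ 'd \<Rightarrow> int ^ 'd \<Rightarrow> real)"
  have "real CARD('d) < p" using assms(1) by (simp add: p_def)
  then obtain S where S: "\<And>F (i :: int ^ 'd). finite F \<Longrightarrow> (\<Sum>j\<in>F. w i j) \<le> S"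
    unfolding w_def by (rule lattice_kernel_sum_bounded) blast
  have w: "C / lattice_dist i j powr (real CARD('d) + \<alpha>) \<le> \<bar>C\<bar> * w i j"
    if "i \<noteq> j" for C and i j :: "int ^ 'd"
    using that by (simp add: w_def lattice_kernel_def p_def divide_right_mono)
  \<comment> \<open>The absolute values make both constants nonnegative.\<close>
  interpret decaying_spin_system \<psi> \<psi>c \<psi>b M \<delta> C0 w S "\<bar>C1\<bar>" "\<bar>C2\<bar>"
  proof
    fix i j :: "int ^ 'd" and z :: real and F \<Lambda> :: "(int ^ 'd) set" and \<omega> :: "'d config"
    show "0 < \<delta>" by fact
    show "continuous_on UNIV (\<psi> i)"
    proof (rule differentiable_imp_continuous_on)
      have "(deriv ^^ 0) (\<psi> i) differentiable (at z)" for z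
        using assms(3)[of i] unfolding smooth_def by blast
      then show "\<psi> i differentiable_on UNIV"
        by (simp add: differentiable_on_def)
    qed
    show "\<psi> i z = \<psi>c i z + \<psi>b i z" by fact
    show "convex_on UNIV (\<psi>c i)"
    proof (rule f''_ge0_imp_convex)
      show "(\<psi>c i has_real_derivative deriv (\<psi>c i) z) (at z)"
           "(deriv (\<psi>c i) has_real_derivative deriv (deriv (\<psi>c i)) z) (at z)" for z
        using assms(5)[of i z] assms(6)[of i z] by (metis DERIV_deriv_iff_real_differentiable)+
    qed (use assms(7) in auto)
    show "\<psi>c i differentiable (at z)" by fact
    show "\<bar>\<psi>b i z\<bar> \<le> C0" using assms(9)[of i z] by linarith
    show "M i j = M j i" by fact
    show "(\<Sum>j\<in>F. \<bar>M i j\<bar>) + \<delta> \<le> M i i" if "finite F" "i \<notin> F"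
    proof -
      have "(\<Sum>j\<in>F. \<bar>M i j\<bar>) \<le> (\<Sum>\<^sub>\<infinity>j\<in>- {i}. \<bar>M i j\<bar>)"
        using that by (intro finite_sum_le_infsum assms(11)) auto
      then show ?thesis using assms(12)[of i] by linarith
    qed
    show "0 \<le> w i j" "1 \<le> w i i" "w i j = w j i"
      by (auto simp: w_def lattice_kernel_def lattice_dist_commute)
    show "(\<Sum>j\<in>F. w i j) \<le> S" if "finite F" using S[OF that] .
    show "0 \<le> \<bar>C1\<bar>" "0 \<le> \<bar>C2\<bar>" by auto
    show "\<bar>M i j\<bar> \<le> \<bar>C1\<bar> * w i j" if "i \<noteq> j"
      using assms(13)[OF that] w[OF that, of C1] by linarith
    show "\<bar>cov (finite_volume_gibbs \<psi> M \<Lambda> \<omega>) (\<lambda>x. x i) (\<lambda>x. x j)\<bar> \<le> \<bar>C2\<bar> * w i j"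
      if "finite \<Lambda>" "tempered M \<Lambda> \<omega>" "i \<in> \<Lambda>" "j \<in> \<Lambda>" "i \<noteq> j"
      using assms(14)[OF that] w[OF that(5), of C2] by linarith
  qed
  show ?thesis by (rule at_most_one_gibbs_measure)
qed

end
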